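(* Let $X,Y$ be infinite-dimensional complex Hilbert spaces, let $W\in\mathcal{B}(Y,X)\setminus\{0\}$, let $A\in\mathcal{B}(X,Y)$ be $W$g-Drazin invertible and let $B\in\mathcal{B}(X,Y)$. Then the following statements are equivalent: (i) $A\leq^{\otimes,W}B$; (ii) the following matrix representations with respect to the orthogonal sums $X=R((WA)^d)\oplus N[((WA)^d)^*]$ and $Y=R((AW)^d)\oplus N[((AW)^d)^*]$ hold: $$A=\begin{bmatrix}A_1&A_2\\0&A_3\end{bmatrix},\quad W=\begin{bmatrix}W_1&W_2\\0&W_3\end{bmatrix},\quad B=\begin{bmatrix}A_1&B_2\\0&B_3\end{bmatrix},$$ where $A_1\in\mathcal{B}(R((WA)^d),R((AW)^d))$ and $W_1\in\mathcal{B}(R((AW)^d),R((WA)^d))$ are invertible, $B_2=A_2+W_1^{-1}W_2(A_3-B_3)+(W_1A_1W_1)^{-1}(W_1A_2+W_2A_3)W_3(A_3-B_3)$, $W_2A_3W_3(A_3-B_3)W_3=0$, and $A_3W_3\in\mathcal{B}(N[((AW)^d)^*])$ and $W_3A_3\in\mathcal{B}(N[((WA)^d)^*])$ are quasinilpotent.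
   Context: $\mathcal{B}(X,Y)$ is the set of bounded linear operators from $X$ to $Y$, $\mathcal{B}(X)=\mathcal{B}(X,X)$; $R(\cdot)$, $N(\cdot)$, $(\cdot)^*$ denote range, null space and adjoint; $P_L$ is the orthogonal projector onto a closed subspace $L$. An operator $T\in\mathcal{B}(X)$ is generalized Drazin invertible if there is a (necessarily unique) $T^d\in\mathcal{B}(X)$ with $TT^d=T^dT$, $T^dTT^d=T^d$ and $T-T^2T^d$ quasinilpotent (and similarly on $Y$). For $W\in\mathcal{B}(Y,X)\setminus\{0\}$, an operator $A\in\mathcal{B}(X,Y)$ is $W$g-Drazin invertible if there is a (necessarily unique) $A^{d,W}=B\in\mathcal{B}(X,Y)$ with $AWB=BWA$, $BWAWB=B$ and $A-AWBWA$ quasinilpotent in the weighted sense, i.e. $(A-AWBWA)W$ is a quasinilpotent operator on $Y$. In that case $AW$ and $WA$ are generalized Drazin invertible with $(AW)^d=A^{d,W}W$ and $(WA)^d=WA^{d,W}$. For a generalized Drazin invertible operator $T$ on a Hilbert space, the core-EP inverse $T^{\mathrm{cEP}}$ is the unique (it exists) operator $B$ with $TB=P_{R(T^d)}$ and $R(B)\subseteq R(T^d)$, and the weak group inverse of $T$ is $T^{\otimes}=(T^{\mathrm{cEP}})^2T$. Weak group relation: for $T$ generalized Drazin invertible and $S$ bounded on the same Hilbert space, $T\leq^{\otimes}S$ means $TT^{\otimes}=ST^{\otimes}$ and $T^{\otimes}T=T^{\otimes}S$. For $A,B\in\mathcal{B}(X,Y)$ with $A$ $W$g-Drazin invertible,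 $A\leq^{\otimes,W}B$ means that both $AW\leq^{\otimes}BW$ and $WA\leq^{\otimes}WB$. *)

theory Defs
  imports "HOL-Analysis.Analysis"
begin

text \<open>
  A complex inner product space is presented on top of its underlying real inner product space
  \<open>(real_inner)\<close>, whose inner product is the real part of the complex one; the norm and the topology
  are therefore those induced by \<open>cinner\<close>. The complex inner product is linear in its first argument.
\<close>

class complex_inner = real_inner +
  fixes scaleC :: "complex \<Rightarrow> 'a \<Rightarrow> 'a"  (infixr "*\<^sub>C" 75)
    and cinner :: "'a \<Rightarrow> 'a \<Rightarrow> complex"
  assumes scaleC_of_real: "complex_of_real r *\<^sub>C x = r *\<^sub>R x"
    and scaleC_add_right: "a *\<^sub>C (x + y) = a *\<^sub>C x + a *\<^sub>C y"
    and scaleC_add_left: "(a + b) *\<^sub>C x = a *\<^sub>C x + b *\<^sub>C x"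
    and scaleC_scaleC: "a *\<^sub>C (b *\<^sub>C x) = (a * b) *\<^sub>C x"
    and cinner_commute: "cinner x y = cnj (cinner y x)"
    and cinner_add_left: "cinner (x + y) z = cinner x z + cinner y z"
    and cinner_scaleC_left: "cinner (a *\<^sub>C x) y = a * cinner x y"
    and inner_eq_Re_cinner: "inner x y = Re (cinner x y)"

class chilbert_space = complex_inner + complete_space

lemma vector_space_scaleC: "vector_space (scaleC :: complex \<Rightarrow> 'a::complex_inner \<Rightarrow> 'a)"
proof
  show "1 *\<^sub>C x = x" for x :: 'a
    using scaleC_of_real[of 1 x] by simp
qed (simp_all add: scaleC_add_right scaleC_add_left scaleC_scaleC)

definition infinite_cdim :: "'a::complex_inner itself \<Rightarrow> bool" where
  "infinite_cdim _ \<longleftrightarrow>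
     \<not> (\<exists>S :: 'a set. finite S \<and> module.span (scaleC :: complex \<Rightarrow> 'a \<Rightarrow> 'a) S = UNIV)"

text \<open>
  \<open>bounded_op M N T\<close> says that the restriction of \<open>T\<close> to the linear subspace \<open>M\<close> is an element of
  \<open>B(M, N)\<close>; nothing is said about \<open>T\<close> outside \<open>M\<close>.
\<close>

definition bounded_op ::
    "'a::complex_inner set \<Rightarrow> 'b::complex_inner set \<Rightarrow> ('a \<Rightarrow> 'b) \<Rightarrow> bool" where
  "bounded_op M N T \<longleftrightarrow>
     (\<forall>x\<in>M. T x \<in> N) \<and>
     (\<forall>x\<in>M. \<forall>y\<in>M. T (x + y) = T x + T y) \<and>
     (\<forall>a. \<forall>x\<in>M. T (a *\<^sub>C x) = a *\<^sub>C T x) \<and>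
     (\<exists>K. \<forall>x\<in>M. norm (T x) \<le> K * norm x)"

abbreviation bounded_operator :: "('a::complex_inner \<Rightarrow> 'b::complex_inner) \<Rightarrow> bool" where
  "bounded_operator T \<equiv> bounded_op UNIV UNIV T"

lemma bounded_operator_iff:
  "bounded_operator T \<longleftrightarrow> bounded_linear T \<and> (\<forall>a x. T (a *\<^sub>C x) = a *\<^sub>C T x)"
proof
  assume T: "bounded_operator T"
  then obtain K where "\<forall>x. norm (T x) \<le> K * norm x"
    by (auto simp: bounded_op_def)
  with T show "bounded_linear T \<and> (\<forall>a x. T (a *\<^sub>C x) = a *\<^sub>C T x)"
    by (auto simp: bounded_op_def scaleC_of_real[symmetric] mult.commute
        intro!: bounded_linear_intro[where K = K])
next
  assume T: "bounded_linear T \<and> (\<forall>a x. T (a *\<^sub>C x) = a *\<^sub>C T x)"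
  then interpret bounded_linear T by simp
  show "bounded_operator T"
    using T bounded by (auto simp: bounded_op_def add mult.commute)
qed

definition invertible_op ::
    "'a::complex_inner set \<Rightarrow> 'b::complex_inner set \<Rightarrow> ('a \<Rightarrow> 'b) \<Rightarrow> bool" where
  "invertible_op M N T \<longleftrightarrow>
     bounded_op M N T \<and>
     (\<exists>S. bounded_op N M S \<and> (\<forall>x\<in>M. S (T x) = x) \<and> (\<forall>y\<in>N. T (S y) = y))"

definition op_spectrum :: "'a::complex_inner set \<Rightarrow> ('a \<Rightarrow> 'a) \<Rightarrow> complex set" where
  "op_spectrum M T = {z. \<not> invertible_op M M (\<lambda>x. z *\<^sub>C x - T x)}"

text \<open>
  Inclusion rather than equality, because \<open>M\<close> may be the zero space, where the spectrum is empty.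
\<close>

definition quasinilpotent_op :: "'a::complex_inner set \<Rightarrow> ('a \<Rightarrow> 'a) \<Rightarrow> bool" where
  "quasinilpotent_op M T \<longleftrightarrow> bounded_op M M T \<and> op_spectrum M T \<subseteq> {0}"

definition null_space :: "('a \<Rightarrow> 'b::zero) \<Rightarrow> 'a set" where
  "null_space T = {x. T x = 0}"

definition cadjoint :: "('a::complex_inner \<Rightarrow> 'b::complex_inner) \<Rightarrow> 'b \<Rightarrow> 'a" where
  "cadjoint T = (THE S. \<forall>x y. cinner (T x) y = cinner x (S y))"

definition orth_proj :: "'a::complex_inner set \<Rightarrow> 'a \<Rightarrow> 'a" where
  "orth_proj L x = (THE y. y \<in> L \<and> (\<forall>z\<in>L. cinner (x - y) z = 0))"

definition is_gdrazin_inv :: "('a::chilbert_space \<Rightarrow> 'a) \<Rightarrow> ('a \<Rightarrow> 'a) \<Rightarrow> bool" where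
  "is_gdrazin_inv T S \<longleftrightarrow>
     bounded_operator S \<and> T \<circ> S = S \<circ> T \<and> S \<circ> T \<circ> S = S \<and>
     quasinilpotent_op UNIV (\<lambda>x. T x - T (T (S x)))"

definition gdrazin_invertible :: "('a::chilbert_space \<Rightarrow> 'a) \<Rightarrow> bool" where
  "gdrazin_invertible T \<longleftrightarrow> (\<exists>S. is_gdrazin_inv T S)"

definition gdrazin_inv :: "('a::chilbert_space \<Rightarrow> 'a) \<Rightarrow> 'a \<Rightarrow> 'a" where
  "gdrazin_inv T = (THE S. is_gdrazin_inv T S)"

definition is_wgdrazin_inv ::
    "('b::chilbert_space \<Rightarrow> 'a::chilbert_space) \<Rightarrow> ('a \<Rightarrow> 'b) \<Rightarrow> ('a \<Rightarrow> 'b) \<Rightarrow> bool" where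
  "is_wgdrazin_inv W A B \<longleftrightarrow>
     bounded_operator B \<and>
     A \<circ> W \<circ> B = B \<circ> W \<circ> A \<and>
     B \<circ> W \<circ> A \<circ> W \<circ> B = B \<and>
     quasinilpotent_op UNIV (\<lambda>y. A (W y) - A (W (B (W (A (W y))))))"

definition wgdrazin_invertible ::
    "('b::chilbert_space \<Rightarrow> 'a::chilbert_space) \<Rightarrow> ('a \<Rightarrow> 'b) \<Rightarrow> bool" where
  "wgdrazin_invertible W A \<longleftrightarrow> (\<exists>B. is_wgdrazin_inv W A B)"

definition core_ep_inv :: "('a::chilbert_space \<Rightarrow> 'a) \<Rightarrow> 'a \<Rightarrow> 'a" where
  "core_ep_inv T =
     (THE B. bounded_operator B \<and> T \<circ> B = orth_proj (range (gdrazin_inv T)) \<and>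
        range B \<subseteq> range (gdrazin_inv T))"

definition weak_group_inv :: "('a::chilbert_space \<Rightarrow> 'a) \<Rightarrow> 'a \<Rightarrow> 'a" where
  "weak_group_inv T = core_ep_inv T \<circ> core_ep_inv T \<circ> T"

text \<open>\<open>T \<le> S\<close> is meant for generalized Drazin invertible \<open>T\<close> and bounded \<open>S\<close>; the definition is total.\<close>

definition weak_group_le :: "('a::chilbert_space \<Rightarrow> 'a) \<Rightarrow> ('a \<Rightarrow> 'a) \<Rightarrow> bool" where
  "weak_group_le T S \<longleftrightarrow>
     T \<circ> weak_group_inv T = S \<circ> weak_group_inv T \<and>
     weak_group_inv T \<circ> T = weak_group_inv T \<circ> S"

definition weighted_weak_group_le ::
    "('b::chilbert_space \<Rightarrow> 'a::chilbert_space) \<Rightarrow> ('a \<Rightarrow> 'b) \<Rightarrow> ('a \<Rightarrow> 'b) \<Rightarrow> bool" where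
  "weighted_weak_group_le W A B \<longleftrightarrow>
     weak_group_le (A \<circ> W) (B \<circ> W) \<and> weak_group_le (W \<circ> A) (W \<circ> B)"

definition orthogonal_sum :: "'a::complex_inner set \<Rightarrow> 'a set \<Rightarrow> bool" where
  "orthogonal_sum M M' \<longleftrightarrow>
     (\<forall>x\<in>M. \<forall>x'\<in>M'. cinner x x' = 0) \<and> (\<forall>z. \<exists>x\<in>M. \<exists>x'\<in>M'. z = x + x')"

text \<open>
  \<open>has_op_matrix M M' N N' T T11 T12 T21 T22\<close>: with respect to the orthogonal sums \<open>M \<oplus> M'\<close> (domain)
  and \<open>N \<oplus> N'\<close> (codomain), \<open>T\<close> is the operator matrix with rows \<open>T11, T12\<close> and \<open>T21, T22\<close>.
\<close>

definition has_op_matrix ::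
    "'a::complex_inner set \<Rightarrow> 'a set \<Rightarrow> 'b::complex_inner set \<Rightarrow> 'b set \<Rightarrow> ('a \<Rightarrow> 'b) \<Rightarrow>
     ('a \<Rightarrow> 'b) \<Rightarrow> ('a \<Rightarrow> 'b) \<Rightarrow> ('a \<Rightarrow> 'b) \<Rightarrow> ('a \<Rightarrow> 'b) \<Rightarrow> bool" where
  "has_op_matrix M M' N N' T T11 T12 T21 T22 \<longleftrightarrow>
     orthogonal_sum M M' \<and> orthogonal_sum N N' \<and>
     bounded_op M N T11 \<and> bounded_op M' N T12 \<and>
     bounded_op M N' T21 \<and> bounded_op M' N' T22 \<and>
     (\<forall>x\<in>M. \<forall>x'\<in>M'. T (x + x') = (T11 x + T12 x') + (T21 x + T22 x'))"

end

theory Submission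
  imports Defs "HOL-Complex_Analysis.Cauchy_Integral_Formula"
begin

text \<open>
  Let \<open>D\<close> be the \<open>W\<close>-weighted g-Drazin inverse of \<open>A\<close>. Then \<open>(AW)\<^sup>d = DW\<close> and \<open>(WA)\<^sup>d = WD\<close>; the operators
  \<open>A\<close> and \<open>W\<close> exchange the two ranges, and between these ranges \<open>D\<close> is the inverse of \<open>WAW\<close>.

  If \<open>p\<close> is the orthogonal projector onto \<open>R(T\<^sup>d)\<close>, the core-EP inverse of \<open>T\<close> is \<open>T\<^sup>d p\<close> and its weak
  group inverse is \<open>T\<^sup>d T\<^sup>d p T\<close>. So \<open>T \<le> U\<close> means that \<open>T = U\<close> on \<open>R(T\<^sup>d)\<close> and \<open>p T T = p T U\<close>. For the
  weighted relation this says that \<open>A = B\<close> on \<open>R((WA)\<^sup>d)\<close>, that \<open>p\<^sub>X WAW(A - B) = 0\<close>, and that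
  \<open>p\<^sub>Y AW(A - B)W = 0\<close>. The second identity is the formula for \<open>B\<^sub>2\<close>; in its presence the third one
  reduces to the condition on \<open>W\<^sub>2A\<^sub>3W\<^sub>3(A\<^sub>3 - B\<^sub>3)W\<^sub>3\<close>.

  Uniqueness of the g-Drazin inverse comes from Liouville's theorem applied to \<open>(I - wN)\<^sup>-\<^sup>1\<close>, which is
  entire when \<open>N\<close> is quasinilpotent.
\<close>

section \<open>Projections and adjoints in complex Hilbert spaces\<close>

interpretation cvs: vector_space "scaleC :: complex \<Rightarrow> 'a::complex_inner \<Rightarrow> 'a"
  by (rule vector_space_scaleC)

lemma cinner_add_right: "cinner x (y + z) = cinner x y + cinner x z"
  by (metis cinner_add_left cinner_commute complex_cnj_add)

lemma cinner_scaleC_right: "cinner x (a *\<^sub>C y) = cnj a * cinner x y"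
  by (metis cinner_commute cinner_scaleC_left complex_cnj_mult)

lemma cinner_zero_left [simp]: "cinner 0 x = 0"
  using cinner_add_left[of 0 0 x] by simp

lemma cinner_zero_right [simp]: "cinner x 0 = 0"
  using cinner_add_right[of x 0 0] by simp

lemma cinner_diff_left: "cinner (x - y) z = cinner x z - cinner y z"
  using cinner_add_left[of "x - y" y z] by simp

lemma cinner_diff_right: "cinner x (y - z) = cinner x y - cinner x z"
  using cinner_add_right[of x "y - z" z] by simp

lemma cinner_self: "cinner x x = complex_of_real ((norm x)\<^sup>2)"
proof -
  have "Im (cinner x x) = 0"
    using arg_cong[OF cinner_commute[of x x], of Im] by simp
  then show ?thesis
    by (simp add: complex_eq_iff dot_square_norm flip: inner_eq_Re_cinner)
qed

lemma cinner_self_eq_zero: "cinner x x = 0 \<longleftrightarrow> x = 0"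
  by (simp add: cinner_self)

lemma cinner_left_cancel: "(\<And>y. cinner y u = cinner y v) \<Longrightarrow> u = v"
  by (metis cinner_diff_right cinner_self_eq_zero right_minus_eq)

text \<open>The class gives homogeneity of the norm only for real scalars; for complex ones it is
  recovered from \<open>cinner_self\<close> and sesquilinearity.\<close>

lemma norm_scaleC: "norm (a *\<^sub>C x) = cmod a * norm x"
proof -
  have "complex_of_real ((norm (a *\<^sub>C x))\<^sup>2) = (a * cnj a) * cinner x x"
    by (simp add: cinner_scaleC_left cinner_scaleC_right del: of_real_power flip: cinner_self)
  also have "\<dots> = complex_of_real ((cmod a * norm x)\<^sup>2)"
    by (simp only: cinner_self power_mult_distrib of_real_mult flip: complex_norm_square)
  finally show ?thesis
    by (simp only: of_real_eq_iff power2_eq_iff_nonneg norm_ge_zero mult_nonneg_nonneg)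
qed

text \<open>Real Cauchy-Schwarz controls only the real part of \<open>cinner\<close>. Multiplying
  \<open>x\<close> by the unimodular number \<open>a\<close> makes the product real and nonnegative
  without changing \<open>norm x\<close>.\<close>

lemma norm_cinner_le: "cmod (cinner x y) \<le> norm x * norm y"
proof (cases "cinner x y = 0")
  case False
  define a where "a = cnj (cinner x y) / complex_of_real (cmod (cinner x y))"
  have "a * cinner x y = complex_of_real (cmod (cinner x y))"
    using False complex_norm_square[of "cinner x y"]
    by (simp add: a_def mult.commute power2_eq_square divide_eq_eq)
  then have "cmod (cinner x y) = inner (a *\<^sub>C x) y"
    by (simp add: cinner_scaleC_left inner_eq_Re_cinner)
  also have "\<dots> \<le> norm (a *\<^sub>C x) * norm y"
    by (rule norm_cauchy_schwarz)
  also have "\<dots> = norm x * norm y"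
    using False by (simp add: norm_scaleC a_def norm_divide)
  finally show ?thesis .
qed auto

lemma bounded_linear_cinner_left: "bounded_linear (\<lambda>x. cinner x y)"
  by (rule bounded_linear_intro[where K = "norm y"])
    (simp_all add: cinner_add_left cinner_scaleC_left norm_cinner_le scaleR_conv_of_real
      flip: scaleC_of_real)

lemma csubspace_imp_subspace: "cvs.subspace L \<Longrightarrow> subspace L"
  by (auto simp: cvs.subspace_def subspace_def simp flip: scaleC_of_real)

section \<open>Nearest points and orthogonal projectors\<close>

text \<open>A minimizing sequence is Cauchy by the parallelogram law, since convexity keeps
  midpoints in \<open>L\<close>; completeness and closedness supply the minimizer.\<close>

lemma nearest_point:
  fixes L :: "'a::{real_inner,complete_space} set"
  assumes "closed L" and "convex L" and "L \<noteq> {}"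
  obtains y where "y \<in> L" and "\<And>z. z \<in> L \<Longrightarrow> norm (x - y) \<le> norm (x - z)"
proof -
  define d where "d = (INF z\<in>L. norm (x - z))"
  have bdd: "bdd_below ((\<lambda>z. norm (x - z)) ` L)"
    by (rule bdd_belowI2[of _ 0]) simp
  have d_le: "d \<le> norm (x - z)" if "z \<in> L" for z
    unfolding d_def using bdd that by (rule cINF_lower)
  have d_nonneg: "0 \<le> d"
    unfolding d_def using \<open>L \<noteq> {}\<close> by (rule cINF_greatest) simp
  have "\<exists>z\<in>L. (norm (x - z))\<^sup>2 < d\<^sup>2 + e" if "e > 0" for e
  proof -
    have "d < sqrt (d\<^sup>2 + e)"
      using that by (intro real_less_rsqrt) simp
    then obtain z where "z \<in> L" "norm (x - z) < sqrt (d\<^sup>2 + e)"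
      using cINF_less_iff[OF \<open>L \<noteq> {}\<close> bdd] unfolding d_def by blast
    then show ?thesis
      using that by (metis norm_ge_zero real_sqrt_less_iff real_sqrt_unique)
  qed
  then have "\<exists>z\<in>L. (norm (x - z))\<^sup>2 < d\<^sup>2 + inverse (Suc n)" for n
    by simp
  then obtain u where u: "\<And>n. u n \<in> L" "\<And>n. (norm (x - u n))\<^sup>2 < d\<^sup>2 + inverse (Suc n)"
    by metis
  \<comment> \<open>The midpoint of \<open>u m\<close> and \<open>u n\<close> has distance at least
    \<open>d\<close> from \<open>x\<close>, so in the parallelogram identity the terms in
    \<open>d\<close> cancel.\<close>
  have near: "(norm (u m - u n))\<^sup>2 \<le> 2 * inverse (Suc m) + 2 * inverse (Suc n)" for m n
  proof -
    have "(1/2) *\<^sub>R u m + (1/2) *\<^sub>R u n \<in> L"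
      using \<open>convex L\<close> u(1) by (intro convexD) auto
    then have "d\<^sup>2 \<le> (norm (x - ((1/2) *\<^sub>R u m + (1/2) *\<^sub>R u n)))\<^sup>2"
      using d_le d_nonneg by (intro power_mono)
    moreover have "(norm (u m - u n))\<^sup>2 = 2 * (norm (x - u m))\<^sup>2 + 2 * (norm (x - u n))\<^sup>2
        - 4 * (norm (x - ((1/2) *\<^sub>R u m + (1/2) *\<^sub>R u n)))\<^sup>2"
      by (simp add: power2_norm_eq_inner algebra_simps inner_commute)
    ultimately show ?thesis
      using u(2)[of m] u(2)[of n] by linarith
  qed
  have "Cauchy u"
  proof (rule metric_CauchyI)
    fix e :: real
    assume "0 < e"
    then have "0 < e\<^sup>2 / 4" by simp
    then obtain k where "inverse (real (Suc k)) < e\<^sup>2 / 4"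
      using reals_Archimedean by blast
    moreover have "inverse (real (Suc n)) \<le> inverse (real (Suc k))" if "n \<ge> k" for n
      using that by simp
    ultimately have *: "inverse (real (Suc n)) < e\<^sup>2 / 4" if "n \<ge> k" for n
      using that by (meson le_less_trans)
    have "(norm (u m - u n))\<^sup>2 < e\<^sup>2" if "m \<ge> k" "n \<ge> k" for m n
    proof -
      have "inverse (real (Suc m)) < e\<^sup>2 / 4" "inverse (real (Suc n)) < e\<^sup>2 / 4"
        using * that by blast+
      with near[of m n] show ?thesis by linarith
    qed
    then have "dist (u m) (u n) < e" if "m \<ge> k" "n \<ge> k" for m n
      using that \<open>0 < e\<close> by (metis dist_norm less_eq_real_def power2_less_imp_less)
    then show "\<exists>M. \<forall>m\<ge>M. \<forall>n\<ge>M. dist (u m) (u n) < e" by blast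
  qed
  then obtain y where y: "u \<longlonglongrightarrow> y"
    by (auto simp: Cauchy_convergent_iff convergent_def)
  have "y \<in> L"
    using \<open>closed L\<close> u(1) y by (rule closed_sequentially)
  moreover have "norm (x - y) \<le> norm (x - z)" if "z \<in> L" for z
  proof -
    have "(norm (x - y))\<^sup>2 \<le> d\<^sup>2 + 0"
    proof (rule LIMSEQ_le)
      show "(\<lambda>n. (norm (x - u n))\<^sup>2) \<longlonglongrightarrow> (norm (x - y))\<^sup>2"
        by (intro tendsto_intros y)
      show "(\<lambda>n. d\<^sup>2 + inverse (real (Suc n))) \<longlonglongrightarrow> d\<^sup>2 + 0"
        by (intro tendsto_add tendsto_const LIMSEQ_inverse_real_of_nat)
      show "\<exists>N. \<forall>n\<ge>N. (norm (x - u n))\<^sup>2 \<le> d\<^sup>2 + inverse (real (Suc n))"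
        by (intro exI allI impI less_imp_le u(2))
    qed
    then have "norm (x - y) \<le> d"
      unfolding add_0_right using d_nonneg by (rule power2_le_imp_le)
    with d_le[OF that] show ?thesis by linarith
  qed
  ultimately show ?thesis
    using that by blast
qed

text \<open>The nearest point works: a nonzero real inner product of \<open>x - y\<close> with a
  direction in \<open>L\<close> would allow a shorter distance, and closure of \<open>L\<close>
  under \<open>\<i>\<close> covers the imaginary part.\<close>

lemma orth_proj_exists:
  fixes L :: "'a::chilbert_space set"
  assumes "closed L" and L: "cvs.subspace L"
  obtains y where "y \<in> L" and "\<And>z. z \<in> L \<Longrightarrow> cinner (x - y) z = 0"
proof -
  have sub: "subspace L"
    using L by (rule csubspace_imp_subspace)
  then obtain y where y: "y \<in> L" "\<And>z. z \<in> L \<Longrightarrow> norm (x - y) \<le> norm (x - z)"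
    using nearest_point[of L x] \<open>closed L\<close> subspace_imp_convex subspace_0 by blast
  have inner: "inner (x - y) z = 0" if "z \<in> L" for z
  proof (rule ccontr)
    assume nz: "inner (x - y) z \<noteq> 0"
    \<comment> \<open>The minimizer over real \<open>t\<close> of the quadratic
      \<open>(norm ((x - y) - t *\<^sub>R z))\<^sup>2\<close>.\<close>
    define t where "t = inner (x - y) z / (norm z)\<^sup>2"
    have z: "(norm z)\<^sup>2 > 0" using nz by auto
    have "y + t *\<^sub>R z \<in> L"
      using sub y(1) that by (simp add: subspace_add subspace_scale)
    from y(2)[OF this] have "(norm (x - y))\<^sup>2 \<le> (norm ((x - y) - t *\<^sub>R z))\<^sup>2"
      by (simp add: power_mono diff_diff_add)
    also have "\<dots> = (norm (x - y))\<^sup>2 - 2 * t * inner (x - y) z + t\<^sup>2 * (norm z)\<^sup>2"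
      unfolding power2_norm_eq_inner inner_diff_left[of "x - y"] inner_diff_right[of _ "x - y"]
      by (simp add: inner_commute power2_eq_square)
    also have "t\<^sup>2 * (norm z)\<^sup>2 = t * inner (x - y) z"
      using z by (simp add: t_def power2_eq_square)
    finally have "t * inner (x - y) z \<le> 0" by simp
    moreover have "t * inner (x - y) z = (inner (x - y) z)\<^sup>2 / (norm z)\<^sup>2"
      by (simp add: t_def power2_eq_square)
    ultimately show False
      using nz z by (metis divide_pos_pos linorder_not_le zero_less_power2)
  qed
  have "cinner (x - y) z = 0" if "z \<in> L" for z
  proof (rule complex_eqI)
    show "Re (cinner (x - y) z) = Re 0"
      using inner[OF that] by (simp add: inner_eq_Re_cinner)
    \<comment> \<open>The imaginary part of \<open>cinner (x - y) z\<close> is the real inner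
      product of \<open>x - y\<close> with \<open>\<i> *\<^sub>C z\<close>.\<close>
    have "\<i> *\<^sub>C z \<in> L"
      using L that by (rule cvs.subspace_scale)
    from inner[OF this] show "Im (cinner (x - y) z) = Im 0"
      by (simp add: inner_eq_Re_cinner cinner_scaleC_right)
  qed
  with y(1) show ?thesis
    using that by blast
qed

lemma orth_proj_unique:
  assumes L: "cvs.subspace L"
    and "y \<in> L" and "\<And>z. z \<in> L \<Longrightarrow> cinner (x - y) z = 0"
  shows "orth_proj L x = y"
  unfolding orth_proj_def
proof (rule the_equality)
  fix y'
  assume y': "y' \<in> L \<and> (\<forall>z\<in>L. cinner (x - y') z = 0)"
  then have "y' - y \<in> L"
    using L assms(2) by (simp add: cvs.subspace_diff)
  then have "cinner (y' - y) (y' - y) = cinner (x - y) (y' - y) - cinner (x - y') (y' - y)"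
    by (simp add: cinner_diff_left)
  also have "\<dots> = 0"
    using \<open>y' - y \<in> L\<close> y' assms(3) by simp
  finally show "y' = y"
    by (simp add: cinner_self_eq_zero)
qed (use assms in auto)

lemma
  fixes L :: "'a::chilbert_space set"
  assumes "closed L" and L: "cvs.subspace L"
  shows orth_proj_in: "orth_proj L x \<in> L"
    and orth_proj_orth: "z \<in> L \<Longrightarrow> cinner (x - orth_proj L x) z = 0"
proof -
  obtain y where "y \<in> L" "\<And>z. z \<in> L \<Longrightarrow> cinner (x - y) z = 0"
    using orth_proj_exists[OF assms] by blast
  moreover from this have "orth_proj L x = y"
    by (rule orth_proj_unique[OF L])
  ultimately show "orth_proj L x \<in> L" "z \<in> L \<Longrightarrow> cinner (x - orth_proj L x) z = 0"
    by auto
qed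

lemma orth_proj_id: "cvs.subspace L \<Longrightarrow> x \<in> L \<Longrightarrow> orth_proj L x = x"
  by (rule orth_proj_unique) auto

lemma bounded_operator_orth_proj:
  fixes L :: "'a::chilbert_space set"
  assumes "closed L" and L: "cvs.subspace L"
  shows "bounded_operator (orth_proj L)"
proof -
  note P = orth_proj_in[OF assms] orth_proj_orth[OF assms]
  have "orth_proj L (x + y) = orth_proj L x + orth_proj L y" for x y
    by (rule orth_proj_unique[OF L])
      (use P L in \<open>auto simp: cvs.subspace_add add_diff_add cinner_add_left\<close>)
  moreover have "orth_proj L (a *\<^sub>C x) = a *\<^sub>C orth_proj L x" for a x
    by (rule orth_proj_unique[OF L])
      (use P L in \<open>auto simp: cvs.subspace_scale cinner_scaleC_left simp flip: cvs.scale_right_diff_distrib\<close>)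
  moreover have "norm (orth_proj L x) \<le> 1 * norm x" for x
  proof -
    let ?p = "orth_proj L x"
    have "complex_of_real ((norm ?p)\<^sup>2) = cinner x ?p"
      using P(2)[OF P(1), of x x] by (simp add: cinner_diff_left cinner_self)
    then have "(norm ?p)\<^sup>2 = cmod (cinner x ?p)"
      by (metis norm_of_real abs_of_nonneg zero_le_power2)
    also have "\<dots> \<le> norm x * norm ?p"
      by (rule norm_cinner_le)
    finally show ?thesis
      by (cases "?p = 0") (auto simp: power2_eq_square)
  qed
  ultimately show ?thesis
    by (auto simp: bounded_op_def intro: exI[of _ 1])
qed

section \<open>Riesz representation and the adjoint\<close>

text \<open>If \<open>f\<close> is nonzero, its kernel \<open>L\<close> is closed and the component
  \<open>e\<close> of \<open>x0\<close> orthogonal to \<open>L\<close> has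
  \<open>f e \<noteq> 0\<close>. Subtracting a multiple of \<open>e\<close> moves any
  \<open>x\<close> into \<open>L\<close>, so \<open>f\<close> is the inner product with a multiple
  of \<open>e\<close>; conjugation enters because \<open>cinner\<close> is antilinear on the
  right.\<close>

lemma Riesz_representation:
  fixes f :: "'a::chilbert_space \<Rightarrow> complex"
  assumes f: "bounded_linear f" and fC: "\<And>a x. f (a *\<^sub>C x) = a * f x"
  obtains v where "\<And>x. f x = cinner x v"
proof (cases "\<forall>x. f x = 0")
  case True
  then show ?thesis using that[of 0] by simp
next
  case False
  then obtain x0 where x0: "f x0 \<noteq> 0" by blast
  interpret f: bounded_linear f by (rule f)
  define L where "L = {x. f x = 0}"
  have sub: "cvs.subspace L"
    by (auto simp: L_def cvs.subspace_def f.add fC f.zero)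
  have "closed L"
    unfolding L_def by (intro closed_Collect_eq f.continuous_on continuous_intros)
  then obtain p where p: "p \<in> L" "\<And>z. z \<in> L \<Longrightarrow> cinner (x0 - p) z = 0"
    using orth_proj_exists sub by blast
  define e where "e = x0 - p"
  have fe: "f e = f x0"
    using p(1) by (simp add: e_def L_def f.diff)
  have e: "e \<noteq> 0"
    using fe x0 f.zero by auto
  have "f x = cinner x (cnj (f e / cinner e e) *\<^sub>C e)" for x
  proof -
    have "x - (f x / f e) *\<^sub>C e \<in> L"
      using fe x0 by (simp add: L_def f.diff fC)
    then have "cinner (x - (f x / f e) *\<^sub>C e) e = 0"
      using p(2) cinner_commute[of _ e] by (simp add: e_def)
    then have "cinner x e = f x / f e * cinner e e"
      by (simp add: cinner_diff_left cinner_scaleC_left)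
    then show ?thesis
      using fe x0 e by (simp add: cinner_scaleC_right cinner_self_eq_zero)
  qed
  then show ?thesis by (rule that)
qed

text \<open>Justifies the definite description in \<open>cadjoint\<close>: Riesz representation
  gives existence, nondegeneracy of \<open>cinner\<close> gives uniqueness.\<close>

lemma cinner_cadjoint:
  fixes T :: "'a::chilbert_space \<Rightarrow> 'b::chilbert_space"
  assumes "bounded_operator T"
  shows "cinner (T x) y = cinner x (cadjoint T y)"
proof -
  interpret T: bounded_linear T
    using assms by (simp add: bounded_operator_iff)
  have "\<exists>v. \<forall>x. cinner (T x) y = cinner x v" for y
  proof -
    have "bounded_linear (\<lambda>x. cinner (T x) y)"
      by (rule bounded_linear_compose[OF bounded_linear_cinner_left T.bounded_linear_axioms])
    moreover have "cinner (T (a *\<^sub>C x)) y = a * cinner (T x) y" for a x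
      using assms by (simp add: bounded_operator_iff cinner_scaleC_left)
    ultimately obtain v where "\<And>x. cinner (T x) y = cinner x v"
      using Riesz_representation[of "\<lambda>x. cinner (T x) y"] by blast
    then show ?thesis by blast
  qed
  then have "\<exists>S. \<forall>y x. cinner (T x) y = cinner x (S y)"
    by (intro choice allI)
  then obtain S where S: "\<forall>x y. cinner (T x) y = cinner x (S y)"
    by blast
  have "cadjoint T = S"
    unfolding cadjoint_def
  proof (rule the_equality)
    fix S'
    assume "\<forall>x y. cinner (T x) y = cinner x (S' y)"
    with S have "cinner x (S' y) = cinner x (S y)" for x y
      by simp
    then show "S' = S"
      using cinner_left_cancel by blast
  qed (rule S)
  with S show ?thesis by simp
qed

text \<open>Allows the second summands of the orthogonal sums to be treated as kernels of orthogonal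
  projectors.\<close>

lemma null_space_cadjoint:
  fixes T :: "'a::chilbert_space \<Rightarrow> 'b::chilbert_space"
  assumes "bounded_operator T"
  shows "null_space (cadjoint T) = {y. \<forall>z\<in>range T. cinner y z = 0}"
proof -
  have "cadjoint T y = 0 \<longleftrightarrow> (\<forall>x. cinner (T x) y = 0)" for y
    using cinner_left_cancel[of "cadjoint T y" 0] by (auto simp: cinner_cadjoint[OF assms])
  moreover have "cinner (T x) y = 0 \<longleftrightarrow> cinner y (T x) = 0" for x y
    using cinner_commute[of "T x" y] by simp
  ultimately show ?thesis
    by (auto simp: null_space_def)
qed

section \<open>Quasinilpotent operators and generalized Drazin inverses\<close>

lemma bounded_operator_comp:
  "bounded_operator S \<Longrightarrow> bounded_operator T \<Longrightarrow> bounded_operator (\<lambda>x. S (T x))"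
  by (auto simp: bounded_operator_iff intro: bounded_linear_compose)

lemma bounded_operator_diff:
  "bounded_operator S \<Longrightarrow> bounded_operator T \<Longrightarrow> bounded_operator (\<lambda>x. S x - T x)"
  by (auto simp: bounded_operator_iff cvs.scale_right_diff_distrib intro: bounded_linear_sub)

lemma bounded_operator_add:
  "bounded_operator S \<Longrightarrow> bounded_operator T \<Longrightarrow> bounded_operator (\<lambda>x. S x + T x)"
  by (auto simp: bounded_operator_iff scaleC_add_right intro: bounded_linear_add)

lemma bounded_linear_scaleC: "bounded_linear (scaleC a)"
  by (rule bounded_linear_intro[where K = "cmod a"])
    (simp_all add: scaleC_add_right norm_scaleC scaleC_scaleC mult.commute flip: scaleC_of_real)

lemma bounded_operator_scaleC:
  "bounded_operator T \<Longrightarrow> bounded_operator (\<lambda>x. a *\<^sub>C T x)"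
  by (auto simp: bounded_operator_iff scaleC_scaleC mult.commute
      intro: bounded_linear_compose[OF bounded_linear_scaleC])

lemma bounded_operator_id: "bounded_operator (\<lambda>x. x)"
  by (simp add: bounded_operator_iff bounded_linear_ident)

section \<open>The entire inverse family of a quasinilpotent operator\<close>

lemma quasinilpotent_op_resolvent:
  assumes "quasinilpotent_op UNIV N" and "z \<noteq> 0"
  obtains R where "bounded_operator R"
    and "\<And>x. R (z *\<^sub>C x - N x) = x" and "\<And>x. z *\<^sub>C R x - N (R x) = x"
proof -
  have "invertible_op UNIV UNIV (\<lambda>x. z *\<^sub>C x - N x)"
    using assms by (auto simp: quasinilpotent_op_def op_spectrum_def)
  then show ?thesis
    using that by (auto simp: invertible_op_def)
qed

text \<open>For \<open>w \<noteq> 0\<close> the inverse of \<open>I - wN\<close> is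
  \<open>1 / w\<close> times the resolvent of \<open>N\<close> at \<open>1 / w\<close>, and for
  \<open>w = 0\<close> it is the identity. The possible spectral point 0 is thereby moved to
  infinity.\<close>

lemma quasinilpotent_imp_inverse_family:
  assumes "quasinilpotent_op UNIV N"
  obtains V where "\<And>w. bounded_operator (V w)"
    and "\<And>w x. V w (x - w *\<^sub>C N x) = x"
    and "\<And>w x. V w x - w *\<^sub>C N (V w x) = x"
proof -
  have N: "bounded_operator N"
    using assms by (simp add: quasinilpotent_op_def)
  interpret N: bounded_linear N
    using N by (simp add: bounded_operator_iff)
  have NC: "N (a *\<^sub>C x) = a *\<^sub>C N x" for a x
    using N by (simp add: bounded_operator_iff)
  have "\<exists>V. bounded_operator V \<and> (\<forall>x. V (x - w *\<^sub>C N x) = x) \<and> (\<forall>x. V x - w *\<^sub>C N (V x) = x)" for w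
  proof (cases "w = 0")
    case True
    then show ?thesis
      by (intro exI[of _ "\<lambda>x. x"]) (simp add: bounded_operator_id)
  next
    case False
    then obtain R where R: "bounded_operator R"
      and R1: "\<And>x. R ((1 / w) *\<^sub>C x - N x) = x" and R2: "\<And>x. (1 / w) *\<^sub>C R x - N (R x) = x"
      using quasinilpotent_op_resolvent[OF assms, of "1 / w"] by auto
    have RC: "R (a *\<^sub>C x) = a *\<^sub>C R x" for a x
      using R by (simp add: bounded_operator_iff)
    have "(1 / w) *\<^sub>C R (x - w *\<^sub>C N x) = x" for x
      using R1[of x] False by (simp add: cvs.scale_right_diff_distrib flip: RC)
    moreover have "(1 / w) *\<^sub>C R x - w *\<^sub>C N ((1 / w) *\<^sub>C R x) = x" for x
      using R2[of x] False by (simp add: NC)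
    ultimately show ?thesis
      using R by (intro exI[of _ "\<lambda>x. (1 / w) *\<^sub>C R x"]) (simp add: bounded_operator_scaleC)
  qed
  then show ?thesis
    using that by metis
qed

text \<open>The resolvent identity first yields strong continuity of \<open>V\<close> and then,
  divided by \<open>w' - w\<close>, the derivative \<open>V w N V w\<close>. The functional
  \<open>\<phi>\<close> reduces everything to scalar holomorphy.\<close>

lemma inverse_family_holomorphic:
  fixes N :: "'a::complex_inner \<Rightarrow> 'a" and \<phi> :: "'a \<Rightarrow> complex"
  assumes N: "bounded_operator N"
    and V: "\<And>w. bounded_operator (V w)"
    and V1: "\<And>w x. V w (x - w *\<^sub>C N x) = x"
    and V2: "\<And>w x. V w x - w *\<^sub>C N (V w x) = x"
    and \<phi>: "bounded_linear \<phi>" and \<phi>C: "\<And>a x. \<phi> (a *\<^sub>C x) = a * \<phi> x"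
  shows "(\<lambda>w. \<phi> (V w x)) holomorphic_on UNIV"
proof -
  have resolvent: "V w' x - V w x = (w' - w) *\<^sub>C V w (N (V w' x))" for w w'
  proof -
    interpret V: bounded_linear "V w"
      using V by (simp add: bounded_operator_iff)
    have VC: "V w (a *\<^sub>C x) = a *\<^sub>C V w x" for a x
      using V by (simp add: bounded_operator_iff)
    have "V w' x - w *\<^sub>C N (V w' x) = x + (w' - w) *\<^sub>C N (V w' x)"
      using V2[of w' x] by (simp add: cvs.scale_left_diff_distrib algebra_simps)
    then have "V w' x = V w (x + (w' - w) *\<^sub>C N (V w' x))"
      by (metis V1)
    then show ?thesis
      by (metis V.add VC add_diff_cancel_left')
  qed
  have cont: "((\<lambda>w'. V w' x) \<longlongrightarrow> V w x) (at w)" for w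
  proof -
    have "bounded_linear (\<lambda>x. V w (N x))"
      using V N by (simp add: bounded_operator_iff bounded_linear_compose)
    then obtain K where K: "K > 0" "\<And>u. norm (V w (N u)) \<le> norm u * K"
      using bounded_linear.pos_bounded by blast
    \<comment> \<open>The resolvent identity bounds the error by a term containing the error itself;
      for \<open>w'\<close> close to \<open>w\<close> at most half of it reappears and is absorbed
      on the left.\<close>
    have le: "norm (V w' x - V w x) \<le> 2 * cmod (w' - w) * K * norm (V w x)"
      if "cmod (w' - w) * K \<le> 1 / 2" for w'
    proof -
      let ?e = "norm (V w' x - V w x)"
      have "?e = cmod (w' - w) * norm (V w (N (V w' x)))"
        by (simp add: resolvent norm_scaleC)
      also have "\<dots> \<le> cmod (w' - w) * (norm (V w' x) * K)"
        by (intro mult_left_mono K) simp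
      also have "\<dots> \<le> cmod (w' - w) * ((norm (V w x) + ?e) * K)"
        using K(1) norm_triangle_sub[of "V w' x" "V w x"]
        by (intro mult_left_mono mult_right_mono) auto
      also have "\<dots> = cmod (w' - w) * K * norm (V w x) + (cmod (w' - w) * K) * ?e"
        by (simp add: algebra_simps)
      also have "\<dots> \<le> cmod (w' - w) * K * norm (V w x) + (1 / 2) * ?e"
        by (intro add_left_mono mult_right_mono that) simp
      finally show ?thesis by simp
    qed
    have "((\<lambda>w'. V w' x - V w x) \<longlongrightarrow> 0) (at w)"
    proof (rule Lim_null_comparison)
      have lim: "((\<lambda>w'. cmod (w' - w) * K) \<longlongrightarrow> cmod (w - w) * K) (at w)"
        by (intro tendsto_intros)
      then have "\<forall>\<^sub>F w' in at w. cmod (w' - w) * K < 1 / 2"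
        by (rule order_tendstoD) simp
      then show "\<forall>\<^sub>F w' in at w. norm (V w' x - V w x) \<le> 2 * cmod (w' - w) * K * norm (V w x)"
        by eventually_elim (simp add: le)
      have "((\<lambda>w'. 2 * cmod (w' - w) * K * norm (V w x))
          \<longlongrightarrow> 2 * cmod (w - w) * K * norm (V w x)) (at w)"
        by (intro tendsto_intros)
      then show "((\<lambda>w'. 2 * cmod (w' - w) * K * norm (V w x)) \<longlongrightarrow> 0) (at w)"
        by simp
    qed
    then show ?thesis
      by (simp add: LIM_zero_iff)
  qed
  interpret \<phi>: bounded_linear \<phi> by (rule \<phi>)
  have "((\<lambda>w. \<phi> (V w x)) has_field_derivative \<phi> (V w (N (V w x)))) (at w)" for w
    unfolding has_field_derivative_iff
  proof (rule Lim_transform_eventually)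
    have "bounded_linear (\<lambda>u. \<phi> (V w (N u)))"
      using bounded_linear_compose[OF \<phi>] bounded_linear_compose[of "V w" N] V N
      by (simp add: bounded_operator_iff)
    then show "((\<lambda>w'. \<phi> (V w (N (V w' x)))) \<longlongrightarrow> \<phi> (V w (N (V w x)))) (at w)"
      using cont by (rule bounded_linear.tendsto)
    show "\<forall>\<^sub>F w' in at w. \<phi> (V w (N (V w' x))) = (\<phi> (V w' x) - \<phi> (V w x)) / (w' - w)"
    proof (rule eventually_at_filter[THEN iffD2], rule always_eventually, intro allI impI)
      fix w' assume "w' \<noteq> w"
      then show "\<phi> (V w (N (V w' x))) = (\<phi> (V w' x) - \<phi> (V w x)) / (w' - w)"
        by (simp add: resolvent \<phi>C flip: \<phi>.diff)
    qed
  qed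
  then show ?thesis
    by (auto simp: holomorphic_on_open)
qed

text \<open>The bound forces the entire function \<open>\<phi> (V w x)\<close> to vanish at
  infinity, hence everywhere; at \<open>w = 0\<close> its value is \<open>\<phi> x\<close>.\<close>

lemma inverse_family_Liouville:
  fixes N :: "'a::complex_inner \<Rightarrow> 'a" and \<phi> :: "'a \<Rightarrow> complex"
  assumes N: "bounded_operator N"
    and V: "\<And>w. bounded_operator (V w)"
    and V1: "\<And>w x. V w (x - w *\<^sub>C N x) = x"
    and V2: "\<And>w x. V w x - w *\<^sub>C N (V w x) = x"
    and \<phi>: "bounded_linear \<phi>" and \<phi>C: "\<And>a x. \<phi> (a *\<^sub>C x) = a * \<phi> x"
    and bound: "\<And>w. cmod w > k \<Longrightarrow> cmod (\<phi> (V w x)) * (cmod w - k) \<le> c"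
  shows "\<phi> x = 0"
proof -
  have "((\<lambda>w. \<phi> (V w x)) \<longlongrightarrow> 0) at_infinity"
  proof (rule Lim_null_comparison)
    show "\<forall>\<^sub>F w in at_infinity. norm (\<phi> (V w x)) \<le> c / (cmod w - k)"
      unfolding eventually_at_infinity
    \<comment> \<open>The radius \<open>k + 1\<close> keeps \<open>cmod w - k\<close> positive, so
      that the bound may be divided by it.\<close>
    proof (intro exI[of _ "k + 1"] allI impI)
      fix w :: complex
      assume "norm w \<ge> k + 1"
      then show "norm (\<phi> (V w x)) \<le> c / (cmod w - k)"
        using bound[of w] by (simp add: pos_le_divide_eq)
    qed
    have "filterlim (\<lambda>w::complex. - k + cmod w) at_top at_infinity"
      by (intro filterlim_tendsto_add_at_top[OF tendsto_const] filterlim_norm_at_top)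
    then have "((\<lambda>w. c / (- k + cmod w)) \<longlongrightarrow> 0) at_infinity"
      by (intro tendsto_divide_0[OF tendsto_const] filterlim_at_top_imp_at_infinity)
    then show "((\<lambda>w. c / (cmod w - k)) \<longlongrightarrow> 0) at_infinity"
      by simp
  qed
  then have "\<phi> (V 0 x) = 0"
    using inverse_family_holomorphic[OF N V V1 V2 \<phi> \<phi>C] by (rule Liouville_weak_0[rotated])
  then show ?thesis
    using V1[of 0 x] by simp
qed


text \<open>From \<open>X = SXN\<close> follows \<open>w X V w = S (X V w - X)\<close>, so
  \<open>X V w\<close> decays like \<open>1 / cmod w\<close>. Testing against each \<open>y\<close>
  brings in Liouville's theorem.\<close>

lemma quasinilpotent_right_factor_zero:
  fixes X :: "'a::complex_inner \<Rightarrow> 'b::complex_inner"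
  assumes N: "quasinilpotent_op UNIV N" and X: "bounded_operator X" and S: "bounded_operator S"
    and eq: "\<And>x. X x = S (X (N x))"
  shows "X x = 0"
proof -
  obtain V where V: "\<And>w. bounded_operator (V w)" "\<And>w x. V w (x - w *\<^sub>C N x) = x"
      "\<And>w x. V w x - w *\<^sub>C N (V w x) = x"
    using quasinilpotent_imp_inverse_family[OF N] by metis
  interpret X: bounded_linear X
    using X by (simp add: bounded_operator_iff)
  interpret S: bounded_linear S
    using S by (simp add: bounded_operator_iff)
  have XC: "X (a *\<^sub>C u) = a *\<^sub>C X u" and SC: "S (a *\<^sub>C v) = a *\<^sub>C S v" for a u v
    using X S by (simp_all add: bounded_operator_iff)
  obtain K where K: "K > 0" "\<And>u. norm (S u) \<le> norm u * K"
    using S.pos_bounded by blast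
  have "cinner (X x) y = 0" for y
  proof (rule inverse_family_Liouville[where \<phi> = "\<lambda>u. cinner (X u) y"])
    show "bounded_operator N"
      using N by (simp add: quasinilpotent_op_def)
    show "bounded_linear (\<lambda>u. cinner (X u) y)"
      by (intro bounded_linear_compose[OF bounded_linear_cinner_left] X.bounded_linear_axioms)
    show "cinner (X (a *\<^sub>C u)) y = a * cinner (X u) y" for a u
      by (simp add: XC cinner_scaleC_left)
    fix w
    assume w: "cmod w > K"
    \<comment> \<open>The equation for \<open>V w\<close> turns \<open>wN\<close> applied to
      \<open>?u\<close> into \<open>?u - x\<close>, which trades the factor \<open>w\<close> for the
      bounded operator \<open>S\<close>.\<close>
    let ?u = "V w x"
    have "w *\<^sub>C X ?u = S (X (w *\<^sub>C N ?u))"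
      by (subst eq) (simp add: XC SC)
    also have "w *\<^sub>C N ?u = ?u - x"
      using V(3)[of w x] by (simp add: algebra_simps)
    finally have "cmod w * norm (X ?u) \<le> norm (X ?u - X x) * K"
      using K(2)[of "X ?u - X x"] by (simp add: X.diff flip: norm_scaleC)
    also have "\<dots> \<le> (norm (X ?u) + norm (X x)) * K"
      using K(1) by (intro mult_right_mono norm_triangle_ineq4) simp
    finally have "norm (X ?u) * (cmod w - K) \<le> norm (X x) * K"
      by (simp add: algebra_simps)
    then have "norm (X ?u) * (cmod w - K) * norm y \<le> norm (X x) * K * norm y"
      by (rule mult_right_mono) simp
    moreover have "cmod (cinner (X ?u) y) * (cmod w - K) \<le> norm (X ?u) * norm y * (cmod w - K)"
      using w by (intro mult_right_mono norm_cinner_le) simp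
    ultimately show "cmod (cinner (X ?u) y) * (cmod w - K) \<le> norm (X x) * K * norm y"
      by (simp add: mult_ac)
  qed (use V in auto)
  then show ?thesis
    by (metis cinner_self_eq_zero)
qed

text \<open>Mirror image of the previous argument: \<open>X = NXS\<close> gives
  \<open>w V w X = V w X S - X S\<close>, and now \<open>V w X\<close> decays.\<close>

lemma quasinilpotent_left_factor_zero:
  fixes X :: "'a::complex_inner \<Rightarrow> 'b::complex_inner"
  assumes N: "quasinilpotent_op UNIV N" and X: "bounded_operator X" and S: "bounded_operator S"
    and eq: "\<And>x. X x = N (X (S x))"
  shows "X x = 0"
proof -
  obtain V where V: "\<And>w. bounded_operator (V w)" "\<And>w x. V w (x - w *\<^sub>C N x) = x"
      "\<And>w x. V w x - w *\<^sub>C N (V w x) = x"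
    using quasinilpotent_imp_inverse_family[OF N] by metis
  have X': "bounded_linear X" and S': "bounded_linear S"
    using X S by (simp_all add: bounded_operator_iff)
  obtain K where K: "K > 0" "\<And>u. norm (S u) \<le> norm u * K"
    using bounded_linear.pos_bounded[OF S'] by blast
  obtain L where L: "L > 0" "\<And>u. norm (X (S u)) \<le> norm u * L"
    using bounded_linear.pos_bounded[OF bounded_linear_compose[OF X' S']] by blast
  have "cinner (X x) y = 0" for y
  proof (rule inverse_family_Liouville[where \<phi> = "\<lambda>u. cinner u y"])
    show "bounded_operator N"
      using N by (simp add: quasinilpotent_op_def)
    show "bounded_linear (\<lambda>u. cinner u y)"
      by (rule bounded_linear_cinner_left)
    show "cinner (a *\<^sub>C u) y = a * cinner u y" for a u
      by (rule cinner_scaleC_left)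
    fix w
    assume w: "cmod w > K"
    interpret V: bounded_linear "V w"
      using V(1) by (simp add: bounded_operator_iff)
    have VC: "V w (a *\<^sub>C u) = a *\<^sub>C V w u" for a u
      using V(1) by (simp add: bounded_operator_iff)
    have VX: "bounded_linear (\<lambda>u. V w (X u))"
      by (intro bounded_linear_compose[OF V.bounded_linear_axioms] X')
    \<comment> \<open>The value of \<open>V w X\<close> at \<open>u\<close> is estimated through its
      value at \<open>S u\<close>, so a pointwise bound does not close up. The operator norm does:
      \<open>k * cmod w \<le> k * K + L\<close>.\<close>
    define k where "k = onorm (\<lambda>u. V w (X u))"
    have k0: "k \<ge> 0"
      unfolding k_def by (rule onorm_pos_le[OF VX])
    have k: "norm (V w (X u)) \<le> k * norm u" for u
      unfolding k_def by (rule onorm[OF VX])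
    have "norm (V w (X u)) \<le> (k * K + L) / cmod w * norm u" for u
    proof -
      have "w *\<^sub>C V w (X u) = V w (X (S u)) - X (S u)"
        using V(2)[of w "X (S u)"] by (subst eq) (simp add: V.diff VC algebra_simps)
      then have "cmod w * norm (V w (X u)) \<le> norm (V w (X (S u))) + norm (X (S u))"
        by (metis norm_scaleC norm_triangle_ineq4)
      also have "\<dots> \<le> k * (norm u * K) + norm u * L"
        using k[of "S u"] K(2)[of u] k0 L(2)[of u]
        by (meson add_mono mult_left_mono order_trans)
      finally have "cmod w * norm (V w (X u)) \<le> k * (norm u * K) + norm u * L" .
      moreover have "cmod w > 0"
        using w K(1) by linarith
      ultimately show ?thesis
        by (simp add: pos_le_divide_eq algebra_simps)
    qed
    then have "k \<le> (k * K + L) / cmod w"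
      unfolding k_def by (rule onorm_bound[rotated]) (use k0 K L in \<open>simp add: k_def\<close>)
    moreover have "cmod w > 0"
      using w K(1) by linarith
    ultimately have kL: "k * (cmod w - K) \<le> L"
      by (simp add: pos_le_divide_eq algebra_simps)
    have "cmod (cinner (V w (X x)) y) \<le> norm (V w (X x)) * norm y"
      by (rule norm_cinner_le)
    also have "\<dots> \<le> k * norm x * norm y"
      by (intro mult_right_mono k) simp
    finally have "cmod (cinner (V w (X x)) y) * (cmod w - K) \<le> k * norm x * norm y * (cmod w - K)"
      using w by (intro mult_right_mono) auto
    also have "\<dots> = k * (cmod w - K) * (norm x * norm y)"
      by simp
    also have "\<dots> \<le> L * (norm x * norm y)"
      by (intro mult_right_mono kL) simp
    finally show "cmod (cinner (V w (X x)) y) * (cmod w - K) \<le> L * (norm x * norm y)" .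
  qed (use V in auto)
  then show ?thesis
    by (metis cinner_self_eq_zero)
qed

section \<open>Uniqueness of the generalized Drazin inverse\<close>

lemma is_gdrazin_invD:
  assumes "is_gdrazin_inv T S"
  shows "bounded_operator S" and "T (S x) = S (T x)" and "S (S (T x)) = S x"
    and "quasinilpotent_op UNIV (\<lambda>x. T x - T (T (S x)))"
proof -
  have *: "T (S z) = S (T z)" for z
    using assms by (simp add: is_gdrazin_inv_def fun_eq_iff)
  then show "T (S x) = S (T x)" .
  have "S \<circ> T \<circ> S = S"
    using assms by (simp add: is_gdrazin_inv_def)
  then have "S (T (S x)) = S x"
    by (metis comp_apply)
  then show "S (S (T x)) = S x"
    by (simp add: *)
qed (use assms in \<open>auto simp: is_gdrazin_inv_def\<close>)

text \<open>
  With \<open>P = TS\<close> and \<open>Q = I - TS'\<close>, both \<open>X = PQ\<close> and \<open>X = QP\<close> absorb the quasinilpotent part of \<open>T\<close>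
  on one side and \<open>S\<close> on the other, hence vanish.
\<close>

lemma gdrazin_inv_unique:
  fixes T :: "'a::chilbert_space \<Rightarrow> 'a"
  assumes T: "bounded_operator T" and S: "is_gdrazin_inv T S" and S': "is_gdrazin_inv T S'"
  shows "S = S'"
proof -
  have absorb: "T (S (T (S' x))) = T (S x) \<and> T (S' (T (S x))) = T (S x)"
    if S: "is_gdrazin_inv T S" and S': "is_gdrazin_inv T S'" for S S' x
  proof -
    note s = is_gdrazin_invD[OF S] and s' = is_gdrazin_invD[OF S']
    interpret T: bounded_linear T
      using T by (simp add: bounded_operator_iff)
    interpret S: bounded_linear S
      using s(1) by (simp add: bounded_operator_iff)
    interpret S': bounded_linear S'
      using s'(1) by (simp add: bounded_operator_iff)
    have "S (T (x - T (S' x))) = 0" for x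
    proof (rule quasinilpotent_right_factor_zero[OF s'(4), where X = "\<lambda>x. S (T (x - T (S' x)))"])
      show "bounded_operator (\<lambda>x. S (T (x - T (S' x))))"
        by (rule bounded_operator_comp[OF s(1) bounded_operator_comp[OF T
              bounded_operator_diff[OF bounded_operator_id bounded_operator_comp[OF T s'(1)]]]])
      show "bounded_operator S" by (rule s(1))
      show "S (T (x - T (S' x))) = S (S (T (T x - T (T (S' x)) - T (S' (T x - T (T (S' x)))))))"
        for x
      proof -
        \<comment> \<open>Idempotence of \<open>I - TS'\<close>.\<close>
        have "x - T (S' x) - T (S' (x - T (S' x))) = x - T (S' x)"
          by (simp add: T.diff S'.diff s'(2) s'(3))
        then have "T x - T (T (S' x)) - T (S' (T x - T (T (S' x)))) = T (x - T (S' x))"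
          by (metis T.diff s'(2))
        then show ?thesis
          by (simp only: s(3))
      qed
    qed
    moreover have "S (T x) - T (S' (S (T x))) = 0" for x
    proof (rule quasinilpotent_left_factor_zero[OF s'(4), where X = "\<lambda>x. S (T x) - T (S' (S (T x)))"])
      show "bounded_operator (\<lambda>x. S (T x) - T (S' (S (T x))))"
        using bounded_operator_comp[OF s(1) T]
        by (intro bounded_operator_diff bounded_operator_comp[OF T bounded_operator_comp[OF s'(1)]])
      show "bounded_operator S" by (rule s(1))
      show "S (T x) - T (S' (S (T x))) = T (S (T (S x)) - T (S' (S (T (S x)))))
          - T (T (S' (S (T (S x)) - T (S' (S (T (S x)))))))" for x
      proof -
        define p where "p = S (T (S x))"
        have "p - T (S' p) - T (S' (p - T (S' p))) = p - T (S' p)"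
          by (simp add: T.diff S'.diff s'(2) s'(3))
        then have "T (p - T (S' p)) - T (T (S' (p - T (S' p)))) = T p - T (S' (T p))"
          by (metis T.diff s'(2))
        moreover have "T p = S (T x)"
          by (simp add: p_def s(2) s(3))
        ultimately show ?thesis
          by (simp only: p_def)
      qed
    qed
    ultimately show ?thesis
      by (simp add: T.diff S.diff s(2))
  qed
  note s = is_gdrazin_invD[OF S] and s' = is_gdrazin_invD[OF S']
  \<comment> \<open>Each of the idempotents \<open>TS\<close> and \<open>TS'\<close> absorbs the
    other, so they coincide; then \<open>S = STS = STS' = S'TS' = S'\<close>.\<close>
  have "T (S x) = T (S' x)" for x
    using absorb[OF S S'] absorb[OF S' S] by metis
  then have "S x = S' x" for x
    by (metis s(2,3) s'(2,3))
  then show ?thesis by blast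
qed

lemma gdrazin_inv_eqI:
  assumes "bounded_operator T" and "is_gdrazin_inv T S"
  shows "gdrazin_inv T = S"
  unfolding gdrazin_inv_def using assms gdrazin_inv_unique by blast

section \<open>Quasinilpotent operators on subspaces and under exchange of factors\<close>

lemma bounded_opI:
  "bounded_operator T \<Longrightarrow> (\<And>x. x \<in> M \<Longrightarrow> T x \<in> N) \<Longrightarrow> bounded_op M N T"
  by (auto simp: bounded_op_def)

text \<open>Matrix entries are determined only on their own subspaces. This transfers invertibility
  from the restrictions of \<open>A\<close> and \<open>W\<close> to arbitrary entries agreeing with
  them there.\<close>

lemma invertible_op_cong:
  assumes "\<And>x. x \<in> M \<Longrightarrow> T x = T' x" and "cvs.subspace M"
  shows "invertible_op M N T \<longleftrightarrow> invertible_op M N T'"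
proof -
  have "bounded_op M N T \<longleftrightarrow> bounded_op M N T'"
    using assms by (simp add: bounded_op_def cvs.subspace_add cvs.subspace_scale)
  moreover have "(\<forall>y\<in>N. T (S y) = y) \<longleftrightarrow> (\<forall>y\<in>N. T' (S y) = y)" if "bounded_op N M S" for S
    using that assms(1) by (simp add: bounded_op_def)
  ultimately show ?thesis
    using assms(1) by (auto simp: invertible_op_def)
qed

lemma quasinilpotent_op_cong:
  assumes "\<And>x. x \<in> M \<Longrightarrow> T x = T' x" and "cvs.subspace M"
  shows "quasinilpotent_op M T \<longleftrightarrow> quasinilpotent_op M T'"
proof -
  have "bounded_op M M T \<longleftrightarrow> bounded_op M M T'"
    using assms by (simp add: bounded_op_def cvs.subspace_add cvs.subspace_scale)
  moreover have "op_spectrum M T = op_spectrum M T'"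
    unfolding op_spectrum_def
    using invertible_op_cong[OF _ assms(2), of "\<lambda>x. z *\<^sub>C x - T x" "\<lambda>x. z *\<^sub>C x - T' x" M for z]
    by (simp add: assms(1))
  ultimately show ?thesis
    by (simp add: quasinilpotent_op_def)
qed

lemma quasinilpotent_opI:
  assumes "bounded_op M M T"
    and "\<And>z. z \<noteq> 0 \<Longrightarrow> invertible_op M M (\<lambda>x. z *\<^sub>C x - T x)"
  shows "quasinilpotent_op M T"
  using assms by (auto simp: quasinilpotent_op_def op_spectrum_def)

text \<open>
  With respect to the range and the kernel of \<open>p\<close>, the operator \<open>N\<close> is strictly block upper triangular
  up to its lower right corner, which therefore inherits the resolvent.
\<close>

lemma quasinilpotent_compression:
  assumes N: "quasinilpotent_op UNIV N" and p: "bounded_operator p"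
    and pp: "\<And>x. p (p x) = p x" and Np: "\<And>x. N (p x) = 0"
  shows "quasinilpotent_op {x. p x = 0} (\<lambda>x. N x - p (N x))"
proof -
  have N': "bounded_operator N"
    using N by (simp add: quasinilpotent_op_def)
  interpret N: bounded_linear N
    using N' by (simp add: bounded_operator_iff)
  interpret p: bounded_linear p
    using p by (simp add: bounded_operator_iff)
  have pC: "p (a *\<^sub>C x) = a *\<^sub>C p x" for a x
    using p by (simp add: bounded_operator_iff)
  have NC: "bounded_operator (\<lambda>x. N x - p (N x))"
    by (rule bounded_operator_diff[OF N' bounded_operator_comp[OF p N']])
  show ?thesis
  proof (rule quasinilpotent_opI)
    show "bounded_op {x. p x = 0} {x. p x = 0} (\<lambda>x. N x - p (N x))"
      using NC by (rule bounded_opI) (simp add: p.diff pp)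
    fix z :: complex
    assume z: "z \<noteq> 0"
    then obtain R where R: "bounded_operator R" "\<And>x. R (z *\<^sub>C x - N x) = x"
        "\<And>x. z *\<^sub>C R x - N (R x) = x"
      using quasinilpotent_op_resolvent[OF N] by metis
    interpret R: bounded_linear R
      using R(1) by (simp add: bounded_operator_iff)
    have RC: "R (a *\<^sub>C x) = a *\<^sub>C R x" for a x
      using R(1) by (simp add: bounded_operator_iff)
    \<comment> \<open>\<open>N\<close> vanishes on the range of \<open>p\<close>, so
      \<open>R\<close> acts there as multiplication by \<open>1 / z\<close> and leaves that range
      invariant. Hence \<open>R\<close> is block triangular too, and its lower right corner is the
      inverse sought.\<close>
    have zRp: "z *\<^sub>C R (p x) = p x" for x
      using R(2)[of "p x"] by (simp add: Np RC)
    have pR: "p (R (p x)) = R (p x)" for x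
    proof -
      have "z *\<^sub>C p (R (p x)) = z *\<^sub>C R (p x)"
        by (simp add: zRp pp flip: pC)
      with z show ?thesis by simp
    qed
    show "invertible_op {x. p x = 0} {x. p x = 0} (\<lambda>x. z *\<^sub>C x - (N x - p (N x)))"
      unfolding invertible_op_def
    proof (intro conjI exI[of _ "\<lambda>x. R x - p (R x)"] ballI)
      show "bounded_op {x. p x = 0} {x. p x = 0} (\<lambda>x. z *\<^sub>C x - (N x - p (N x)))"
        using bounded_operator_diff[OF bounded_operator_scaleC[OF bounded_operator_id] NC]
        by (rule bounded_opI) (simp add: p.diff pp pC)
      show "bounded_op {x. p x = 0} {x. p x = 0} (\<lambda>x. R x - p (R x))"
        using bounded_operator_diff[OF R(1) bounded_operator_comp[OF p R(1)]]
        by (rule bounded_opI) (simp add: p.diff pp)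
    next
      fix x assume "x \<in> {x. p x = 0}"
      moreover have "R (z *\<^sub>C x - (N x - p (N x))) = x + R (p (N x))"
        using R(2)[of x] by (simp add: R.diff)
      ultimately show "R (z *\<^sub>C x - (N x - p (N x))) - p (R (z *\<^sub>C x - (N x - p (N x)))) = x"
        by (simp add: p.add pR)
    next
      fix x assume x: "x \<in> {x. p x = 0}"
      have "p (z *\<^sub>C R x - N (R x)) = 0"
        using R(3)[of x] x by simp
      then have "z *\<^sub>C p (R x) = p (N (R x))"
        by (simp add: p.diff pC)
      then show "z *\<^sub>C (R x - p (R x)) - (N (R x - p (R x)) - p (N (R x - p (R x)))) = x"
        using R(3)[of x] by (simp add: N.diff Np cvs.scale_right_diff_distrib)
    qed
  qed
qed

text \<open>Jacobson's lemma: for \<open>z \<noteq> 0\<close>, if \<open>R\<close> inverts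
  \<open>zI - MW\<close>, then \<open>(1 / z) (I + W R M)\<close> inverts
  \<open>zI - WM\<close>.\<close>

lemma quasinilpotent_op_commute:
  fixes M :: "'a::complex_inner \<Rightarrow> 'b::complex_inner"
  assumes M: "bounded_operator M" and W: "bounded_operator W"
    and MW: "quasinilpotent_op UNIV (\<lambda>y. M (W y))"
  shows "quasinilpotent_op UNIV (\<lambda>x. W (M x))"
proof (rule quasinilpotent_opI)
  show WM: "bounded_operator (\<lambda>x. W (M x))"
    using W M by (rule bounded_operator_comp)
  interpret M: bounded_linear M
    using M by (simp add: bounded_operator_iff)
  interpret W: bounded_linear W
    using W by (simp add: bounded_operator_iff)
  have MC: "M (a *\<^sub>C x) = a *\<^sub>C M x" and WC: "W (a *\<^sub>C y) = a *\<^sub>C W y" for a x y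
    using M W by (simp_all add: bounded_operator_iff)
  fix z :: complex
  assume z: "z \<noteq> 0"
  then obtain R where R: "bounded_operator R" "\<And>x. R (z *\<^sub>C x - M (W x)) = x"
      "\<And>x. z *\<^sub>C R x - M (W (R x)) = x"
    using quasinilpotent_op_resolvent[OF MW] by metis
  show "invertible_op UNIV UNIV (\<lambda>x. z *\<^sub>C x - W (M x))"
    unfolding invertible_op_def
  proof (intro conjI exI[of _ "\<lambda>x. (1 / z) *\<^sub>C (x + W (R (M x)))"] ballI)
    show "bounded_operator (\<lambda>x. z *\<^sub>C x - W (M x))"
      using bounded_operator_diff[OF bounded_operator_scaleC[OF bounded_operator_id] WM] .
    show "bounded_operator (\<lambda>x. (1 / z) *\<^sub>C (x + W (R (M x))))"
      using bounded_operator_scaleC[OF bounded_operator_add[OF bounded_operator_id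
            bounded_operator_comp[OF W bounded_operator_comp[OF R(1) M]]]] .
  next
    fix x
    have "R (M (z *\<^sub>C x - W (M x))) = M x"
      using R(2)[of "M x"] by (simp add: M.diff MC)
    then show "(1 / z) *\<^sub>C (z *\<^sub>C x - W (M x) + W (R (M (z *\<^sub>C x - W (M x))))) = x"
      using z by simp
  next
    fix x
    have "W (z *\<^sub>C R (M x) - M (W (R (M x)))) = W (M x)"
      using R(3)[of "M x"] by simp
    then have "z *\<^sub>C W (R (M x)) = W (M x) + W (M (W (R (M x))))"
      by (simp add: W.diff WC algebra_simps)
    then have "z *\<^sub>C (x + W (R (M x))) - W (M (x + W (R (M x)))) = z *\<^sub>C x"
      by (simp add: scaleC_add_right M.add W.add)
    then have "(1 / z) *\<^sub>C (z *\<^sub>C (x + W (R (M x))) - W (M (x + W (R (M x))))) = x"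
      using z by simp
    then show "z *\<^sub>C (1 / z) *\<^sub>C (x + W (R (M x))) - W (M ((1 / z) *\<^sub>C (x + W (R (M x))))) = x"
      using z by (simp add: MC WC cvs.scale_right_diff_distrib)
  qed
qed

section \<open>The weak group relation\<close>

context
  fixes T S :: "'a::chilbert_space \<Rightarrow> 'a"
  assumes T: "bounded_operator T" and S: "is_gdrazin_inv T S"
begin

interpretation T: bounded_linear T
  using T by (simp add: bounded_operator_iff)

interpretation S: bounded_linear S
  using is_gdrazin_invD(1)[OF S] by (simp add: bounded_operator_iff)

text \<open>\<open>ST\<close> is idempotent with the same range as \<open>S\<close>. Membership thus
  becomes a fixed point equation, from which linearity and closedness of the range are
  immediate.\<close>

lemma in_range_gdrazin_iff: "x \<in> range S \<longleftrightarrow> S (T x) = x"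
  using is_gdrazin_invD(2,3)[OF S] by (metis rangeE rangeI)

lemma in_range_gdrazinD: "x \<in> range S \<Longrightarrow> S (T x) = x" "x \<in> range S \<Longrightarrow> T (S x) = x"
  using is_gdrazin_invD(2)[OF S] by (simp_all add: in_range_gdrazin_iff)

lemma in_range_gdrazin_image: "x \<in> range S \<Longrightarrow> T x \<in> range S"
  using is_gdrazin_invD(2)[OF S] by (metis rangeE rangeI)

lemma csubspace_range_gdrazin: "cvs.subspace (range S)"
proof -
  have "S (T (a *\<^sub>C x)) = a *\<^sub>C S (T x)" for a x
    using T is_gdrazin_invD(1)[OF S] by (simp add: bounded_operator_iff)
  then show ?thesis
    by (simp add: cvs.subspace_def in_range_gdrazin_iff T.add S.add T.zero S.zero)
qed

lemma closed_range_gdrazin: "closed (range S)"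
proof -
  have "range S = {x. S (T x) = x}"
    using in_range_gdrazin_iff by blast
  then show ?thesis
    by (simp add: closed_Collect_eq S.continuous_on T.continuous_on)
qed

lemmas gdrazin_proj_in = orth_proj_in[OF closed_range_gdrazin csubspace_range_gdrazin]
  and gdrazin_proj_orth = orth_proj_orth[OF closed_range_gdrazin csubspace_range_gdrazin]
  and gdrazin_proj_id = orth_proj_id[OF csubspace_range_gdrazin]
  and bounded_operator_gdrazin_proj =
    bounded_operator_orth_proj[OF closed_range_gdrazin csubspace_range_gdrazin]

section \<open>Core-EP and weak group inverses in terms of the g-Drazin inverse\<close>

text \<open>On the range of \<open>S\<close> the operators \<open>T\<close> and \<open>S\<close> are
  mutually inverse, so any \<open>B\<close> with values there satisfies \<open>B = S T B\<close>,
  and \<open>T B\<close> is prescribed to be the projector.\<close>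

lemma core_ep_inv_eq: "core_ep_inv T = S \<circ> orth_proj (range S)"
  unfolding core_ep_inv_def gdrazin_inv_eqI[OF T S]
proof (rule the_equality)
  show "bounded_operator (S \<circ> orth_proj (range S)) \<and>
      T \<circ> (S \<circ> orth_proj (range S)) = orth_proj (range S) \<and>
      range (S \<circ> orth_proj (range S)) \<subseteq> range S"
    using bounded_operator_comp[OF is_gdrazin_invD(1)[OF S] bounded_operator_gdrazin_proj]
    by (auto simp: comp_def in_range_gdrazinD(2)[OF gdrazin_proj_in])
next
  fix B
  assume B: "bounded_operator B \<and> T \<circ> B = orth_proj (range S) \<and> range B \<subseteq> range S"
  have "B x = S (orth_proj (range S) x)" for x
  proof -
    have "B x = S (T (B x))"
      using B in_range_gdrazinD(1)[of "B x"] by (metis rangeI subsetD)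
    also have "T (B x) = orth_proj (range S) x"
      using B by (metis comp_apply)
    finally show ?thesis .
  qed
  then show "B = S \<circ> orth_proj (range S)"
    by auto
qed

text \<open>One of the two projectors disappears because \<open>S\<close> already takes values in
  its own range.\<close>

lemma weak_group_inv_eq: "weak_group_inv T = (\<lambda>x. S (S (orth_proj (range S) (T x))))"
  by (auto simp: weak_group_inv_def core_ep_inv_eq gdrazin_proj_id)

text \<open>The first equation concerns the range of the weak group inverse, which is all of
  \<open>range S\<close>. In the second the two factors \<open>S\<close> cancel, being injective on
  \<open>range S\<close>.\<close>

lemma weak_group_le_iff:
  "weak_group_le T U \<longleftrightarrow>
    (\<forall>x\<in>range S. T x = U x) \<and>
    (\<forall>x. orth_proj (range S) (T (T x)) = orth_proj (range S) (T (U x)))"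
proof -
  let ?p = "orth_proj (range S)"
  have "(\<forall>x. T (S (S (?p (T x)))) = U (S (S (?p (T x))))) \<longleftrightarrow> (\<forall>x\<in>range S. T x = U x)"
  proof (intro iffI ballI allI)
    fix x
    assume eq: "\<forall>x. T (S (S (?p (T x)))) = U (S (S (?p (T x))))" and x: "x \<in> range S"
    \<comment> \<open>The weak group inverse takes the value \<open>x\<close> at \<open>T x\<close>,
      so it maps onto \<open>range S\<close>.\<close>
    have "S (S (?p (T (T x)))) = x"
      using x by (simp add: gdrazin_proj_id in_range_gdrazin_image in_range_gdrazinD)
    then show "T x = U x"
      using eq by metis
  qed auto
  moreover have "S (S (?p u)) = S (S (?p v)) \<longleftrightarrow> ?p u = ?p v" for u v
    by (metis gdrazin_proj_in in_range_gdrazinD(2) rangeI)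
  ultimately show ?thesis
    by (simp add: weak_group_le_def weak_group_inv_eq fun_eq_iff)
qed

lemma null_space_cadjoint_gdrazin:
  "x \<in> null_space (cadjoint S) \<longleftrightarrow> orth_proj (range S) x = 0"
proof
  assume "x \<in> null_space (cadjoint S)"
  then show "orth_proj (range S) x = 0"
    using null_space_cadjoint[OF is_gdrazin_invD(1)[OF S]] csubspace_range_gdrazin
    by (intro orth_proj_unique) (auto simp: cvs.subspace_def)
next
  assume "orth_proj (range S) x = 0"
  then show "x \<in> null_space (cadjoint S)"
    using null_space_cadjoint[OF is_gdrazin_invD(1)[OF S]] gdrazin_proj_orth[of _ x] by auto
qed

text \<open>The quasinilpotent part \<open>T - TTS\<close> vanishes on \<open>range S\<close> and
  differs from \<open>T\<close> by an operator with values in \<open>range S\<close>, so both have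
  the same compression to the orthogonal complement.\<close>

lemma gdrazin_compression_quasinilpotent:
  "quasinilpotent_op (null_space (cadjoint S)) (\<lambda>x. T x - orth_proj (range S) (T x))"
proof -
  have "quasinilpotent_op {x. orth_proj (range S) x = 0}
      (\<lambda>x. (T x - T (T (S x))) - orth_proj (range S) (T x - T (T (S x))))"
  proof (rule quasinilpotent_compression[OF is_gdrazin_invD(4)[OF S] bounded_operator_gdrazin_proj])
    show "orth_proj (range S) (orth_proj (range S) x) = orth_proj (range S) x" for x
      by (rule gdrazin_proj_id[OF gdrazin_proj_in])
    show "T (orth_proj (range S) x) - T (T (S (orth_proj (range S) x))) = 0" for x
      by (simp add: in_range_gdrazinD[OF gdrazin_proj_in])
  qed
  moreover have "(T x - T (T (S x))) - orth_proj (range S) (T x - T (T (S x)))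
      = T x - orth_proj (range S) (T x)" for x
  proof -
    interpret p: bounded_linear "orth_proj (range S)"
      using bounded_operator_gdrazin_proj by (simp add: bounded_operator_iff)
    have "orth_proj (range S) (T (T (S x))) = T (T (S x))"
      by (intro gdrazin_proj_id in_range_gdrazin_image) simp
    then show ?thesis
      by (simp add: p.diff)
  qed
  moreover have "null_space (cadjoint S) = {x. orth_proj (range S) x = 0}"
    using null_space_cadjoint_gdrazin by blast
  ultimately show ?thesis
    by simp
qed

end

section \<open>Block matrices for the weighted relation\<close>

text \<open>The algebraic identities carry over directly. Quasinilpotency is assumed for
  \<open>MW\<close> with \<open>M = A - AWDWA\<close>; the second claim needs it for
  \<open>WM\<close>, which \<open>quasinilpotent_op_commute\<close> provides.\<close>

lemma wgdrazin_imp_gdrazin: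
  fixes A :: "'a::chilbert_space \<Rightarrow> 'b::chilbert_space" and W :: "'b \<Rightarrow> 'a"
  assumes A: "bounded_operator A" and W: "bounded_operator W" and D: "is_wgdrazin_inv W A D"
  shows "is_gdrazin_inv (A \<circ> W) (D \<circ> W)" and "is_gdrazin_inv (W \<circ> A) (W \<circ> D)"
proof -
  have bD: "bounded_operator D"
    and comm: "A (W (D x)) = D (W (A x))"
    and inv: "D (W (A (W (D x)))) = D x"
    and qn: "quasinilpotent_op UNIV (\<lambda>y. A (W y) - A (W (D (W (A (W y))))))" for x
    using D by (auto simp: is_wgdrazin_inv_def fun_eq_iff)
  show "is_gdrazin_inv (A \<circ> W) (D \<circ> W)"
    unfolding is_gdrazin_inv_def
  proof (intro conjI)
    show "bounded_operator (D \<circ> W)"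
      using bounded_operator_comp[OF bD W] by (simp add: comp_def)
    show "A \<circ> W \<circ> (D \<circ> W) = D \<circ> W \<circ> (A \<circ> W)"
      by (simp add: fun_eq_iff comm)
    show "D \<circ> W \<circ> (A \<circ> W) \<circ> (D \<circ> W) = D \<circ> W"
      by (simp add: fun_eq_iff inv)
    show "quasinilpotent_op UNIV (\<lambda>x. (A \<circ> W) x - (A \<circ> W) ((A \<circ> W) ((D \<circ> W) x)))"
      using qn by (simp add: comm)
  qed
  interpret A: bounded_linear A
    using A by (simp add: bounded_operator_iff)
  interpret W: bounded_linear W
    using W by (simp add: bounded_operator_iff)
  show "is_gdrazin_inv (W \<circ> A) (W \<circ> D)"
    unfolding is_gdrazin_inv_def
  proof (intro conjI)
    show "bounded_operator (W \<circ> D)"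
      using bounded_operator_comp[OF W bD] by (simp add: comp_def)
    show "W \<circ> A \<circ> (W \<circ> D) = W \<circ> D \<circ> (W \<circ> A)"
      by (simp add: fun_eq_iff comm)
    show "W \<circ> D \<circ> (W \<circ> A) \<circ> (W \<circ> D) = W \<circ> D"
      by (simp add: fun_eq_iff inv)
    have M: "bounded_operator (\<lambda>x. A x - A (W (D (W (A x)))))"
      using bounded_operator_comp[OF W A] bounded_operator_comp[OF A bounded_operator_comp[OF W bD]]
      by (intro bounded_operator_diff A) (rule bounded_operator_comp)
    have "quasinilpotent_op UNIV (\<lambda>x. W (A x - A (W (D (W (A x))))))"
      by (rule quasinilpotent_op_commute[OF M W]) (rule qn)
    then show "quasinilpotent_op UNIV (\<lambda>x. (W \<circ> A) x - (W \<circ> A) ((W \<circ> A) ((W \<circ> D) x)))"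
      by (simp add: W.diff comm)
  qed
qed

section \<open>Orthogonal sums and upper triangular operator matrices\<close>

lemma orthogonal_sum_kernel_orth_proj:
  fixes L :: "'a::chilbert_space set"
  assumes "closed L" and "cvs.subspace L"
  shows "orthogonal_sum L {x. orth_proj L x = 0}"
  unfolding orthogonal_sum_def
proof (intro conjI ballI allI)
  fix x x' assume "x \<in> L" "x' \<in> {x. orth_proj L x = 0}"
  then have "cinner x' x = 0"
    using orth_proj_orth[OF assms, of x x'] by simp
  then show "cinner x x' = 0"
    using cinner_commute[of x x'] by simp
next
  fix z
  interpret p: bounded_linear "orth_proj L"
    using bounded_operator_orth_proj[OF assms] by (simp add: bounded_operator_iff)
  have "orth_proj L z \<in> L"
    by (rule orth_proj_in[OF assms])
  moreover from this have "z - orth_proj L z \<in> {x. orth_proj L x = 0}"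
    by (simp add: p.diff orth_proj_id[OF assms(2)])
  ultimately show "\<exists>x\<in>L. \<exists>x'\<in>{x. orth_proj L x = 0}. z = x + x'"
    by (metis add_diff_cancel_left' diff_add_cancel add.commute)
qed

text \<open>All entries are forced on their subspaces by projecting \<open>T\<close>, and a zero
  lower left entry means invariance. This replaces operator matrices by statements about
  projectors.\<close>

lemma has_op_matrix_upper_iff:
  fixes T :: "'a::chilbert_space \<Rightarrow> 'b::chilbert_space"
  assumes T: "bounded_operator T"
    and M: "closed M" "cvs.subspace M" "M' = {x. orth_proj M x = 0}"
    and N: "closed N" "cvs.subspace N" "N' = {x. orth_proj N x = 0}"
  shows "has_op_matrix M M' N N' T T11 T12 (\<lambda>_. 0) T22 \<longleftrightarrow>
    (\<forall>x\<in>M. T x \<in> N \<and> T11 x = T x) \<and>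
    (\<forall>x\<in>M'. T12 x = orth_proj N (T x) \<and> T22 x = T x - orth_proj N (T x))"
    (is "?matrix \<longleftrightarrow> ?blocks")
proof -
  let ?p = "orth_proj N"
  have p: "bounded_operator ?p"
    by (rule bounded_operator_orth_proj[OF N(1,2)])
  interpret T: bounded_linear T
    using T by (simp add: bounded_operator_iff)
  interpret p: bounded_linear ?p
    using p by (simp add: bounded_operator_iff)
  interpret q: bounded_linear "orth_proj M"
    using bounded_operator_orth_proj[OF M(1,2)] by (simp add: bounded_operator_iff)
  note p_in = orth_proj_in[OF N(1,2)] and p_id = orth_proj_id[OF N(2)]
  have sub': "cvs.subspace M'"
    using bounded_operator_orth_proj[OF M(1,2)]
    by (auto simp: cvs.subspace_def M(3) q.add q.zero bounded_operator_iff)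
  have 0: "0 \<in> M" "0 \<in> M'"
    using M(2) sub' by (simp_all add: cvs.subspace_0)
  show ?thesis
  proof
    assume mat: ?matrix
    \<comment> \<open>The entries are linear only on their subspaces; their values at 0 are needed
      to isolate one summand at a time.\<close>
    have zero: "T11 0 = 0" "T12 0 = 0" "T22 0 = 0"
      using mat 0 cvs.scale_zero_left unfolding has_op_matrix_def bounded_op_def by metis+
    have eq: "T (x + x') = T11 x + T12 x' + T22 x'" if "x \<in> M" "x' \<in> M'" for x x'
      using mat that by (simp add: has_op_matrix_def add.assoc)
    have in_blocks: "x \<in> M \<Longrightarrow> T11 x \<in> N" "x \<in> M' \<Longrightarrow> T12 x \<in> N" "x \<in> M' \<Longrightarrow> ?p (T22 x) = 0" for x
      using mat by (auto simp: has_op_matrix_def bounded_op_def N(3))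
    show ?blocks
    proof (intro conjI ballI)
      fix x assume x: "x \<in> M"
      show "T11 x = T x"
        using eq[OF x 0(2)] by (simp add: zero)
      with in_blocks(1)[OF x] show "T x \<in> N" by simp
    next
      fix x assume x: "x \<in> M'"
      have Tx: "T x = T12 x + T22 x"
        using eq[OF 0(1) x] by (simp add: zero)
      then show "T12 x = ?p (T x)"
        using in_blocks(2,3)[OF x] by (simp add: p.add p_id)
      with Tx show "T22 x = T x - ?p (T x)"
        by (simp add: eq_diff_eq add.commute)
    qed
  next
    assume blocks: ?blocks
    have "bounded_op M N T"
      using T by (rule bounded_opI) (use blocks in blast)
    then have "bounded_op M N T11"
      using blocks M(2) by (simp add: bounded_op_def cvs.subspace_add cvs.subspace_scale)
    moreover have "bounded_op M' N (\<lambda>x. ?p (T x))"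
      using bounded_operator_comp[OF p T] by (rule bounded_opI) (rule p_in)
    then have "bounded_op M' N T12"
      using blocks sub' by (simp add: bounded_op_def cvs.subspace_add cvs.subspace_scale)
    moreover have "bounded_op M N' (\<lambda>_. 0)"
      by (auto simp: bounded_op_def N(3) p.zero intro: exI[of _ 0])
    moreover have "bounded_op M' N' (\<lambda>x. T x - ?p (T x))"
      using bounded_operator_diff[OF T bounded_operator_comp[OF p T]]
      by (rule bounded_opI) (simp add: N(3) p.diff p_id[OF p_in])
    then have "bounded_op M' N' T22"
      using blocks sub' by (simp add: bounded_op_def cvs.subspace_add cvs.subspace_scale)
    ultimately show ?matrix
      using blocks orthogonal_sum_kernel_orth_proj[OF M(1,2)] orthogonal_sum_kernel_orth_proj[OF N(1,2)]
      by (simp add: has_op_matrix_def M(3) N(3) T.add)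
  qed
qed

section \<open>The weighted relation expressed through projectors\<close>

context
  fixes A B D :: "'a::chilbert_space \<Rightarrow> 'b::chilbert_space" and W :: "'b \<Rightarrow> 'a"
    and pX :: "'a \<Rightarrow> 'a" and pY :: "'b \<Rightarrow> 'b"
  assumes W: "bounded_operator W" and A: "bounded_operator A" and B: "bounded_operator B"
    and D: "is_wgdrazin_inv W A D"
  defines "pX \<equiv> orth_proj (range (W \<circ> D))" and "pY \<equiv> orth_proj (range (D \<circ> W))"
begin

private lemma AW: "bounded_operator (A \<circ> W)" and WA: "bounded_operator (W \<circ> A)"
  using bounded_operator_comp[OF A W] bounded_operator_comp[OF W A] by (simp_all add: comp_def)

private lemmas gY = wgdrazin_imp_gdrazin(1)[OF A W D]
  and gX = wgdrazin_imp_gdrazin(2)[OF A W D]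

private lemma bounded_operator_D: "bounded_operator D"
  using D by (simp add: is_wgdrazin_inv_def)

interpretation W: bounded_linear W
  using W by (simp add: bounded_operator_iff)
interpretation A: bounded_linear A
  using A by (simp add: bounded_operator_iff)
interpretation B: bounded_linear B
  using B by (simp add: bounded_operator_iff)
interpretation D: bounded_linear D
  using bounded_operator_D by (simp add: bounded_operator_iff)
interpretation pX: bounded_linear pX
  using bounded_operator_gdrazin_proj[OF WA gX] by (simp add: bounded_operator_iff pX_def)
interpretation pY: bounded_linear pY
  using bounded_operator_gdrazin_proj[OF AW gY] by (simp add: bounded_operator_iff pY_def)

private lemma AWD: "A (W (D x)) = D (W (A x))"
  using D by (auto simp: is_wgdrazin_inv_def fun_eq_iff)

private lemma A_range: "x \<in> range (W \<circ> D) \<Longrightarrow> A x \<in> range (D \<circ> W)"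
  and W_range: "y \<in> range (D \<circ> W) \<Longrightarrow> W y \<in> range (W \<circ> D)"
  and D_range: "x \<in> range (W \<circ> D) \<Longrightarrow> D x \<in> range (D \<circ> W)"
  by (auto simp: AWD)

private lemma WAWD: "x \<in> range (W \<circ> D) \<Longrightarrow> W (A (W (D x))) = x"
  and DWAW: "y \<in> range (D \<circ> W) \<Longrightarrow> D (W (A (W y))) = y"
  using in_range_gdrazinD(2)[OF WA gX, of x] in_range_gdrazinD(1)[OF AW gY, of y] by simp_all

private lemmas pX_in = gdrazin_proj_in[OF WA gX, folded pX_def]
  and pY_in = gdrazin_proj_in[OF AW gY, folded pY_def]
  and pX_id = gdrazin_proj_id[OF WA gX, folded pX_def]
  and pY_id = gdrazin_proj_id[OF AW gY, folded pY_def]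

text \<open>The two agreement conditions, for \<open>AW\<close> with \<open>BW\<close> and for
  \<open>WA\<close> with \<open>WB\<close>, merge into one: \<open>W\<close> maps
  \<open>range (D \<circ> W)\<close> onto \<open>range (W \<circ> D)\<close> and is injective on
  it.\<close>

private lemma weighted_weak_group_le_iff_agree:
  "weighted_weak_group_le W A B \<longleftrightarrow>
    (\<forall>x\<in>range (W \<circ> D). A x = B x) \<and>
    (\<forall>x. pX (W (A (W (A x - B x)))) = 0) \<and>
    (\<forall>y. pY (A (W (A (W y) - B (W y)))) = 0)"
proof -
  have "(\<forall>y\<in>range (D \<circ> W). A (W y) = B (W y)) \<longleftrightarrow> (\<forall>x\<in>range (W \<circ> D). A x = B x)"
    using W_range D_range WAWD A_range by (metis (no_types, lifting))
  then show ?thesis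
    unfolding weighted_weak_group_le_def weak_group_le_iff[OF AW gY, folded pY_def]
      weak_group_le_iff[OF WA gX, folded pX_def]
    by (auto simp: W.diff A.diff pX.diff pY.diff)
qed

text \<open>Since \<open>A - B\<close> vanishes on \<open>range (W \<circ> D)\<close>, testing on
  the kernels of the projectors suffices. The nested \<open>let\<close> is
  \<open>W2 A3 W3 (A3 - B3) W3\<close> applied to \<open>y\<close>, one factor at a time.\<close>

private lemma weighted_weak_group_le_iff_blocks:
  "weighted_weak_group_le W A B \<longleftrightarrow>
    (\<forall>x\<in>range (W \<circ> D). A x = B x) \<and>
    (\<forall>x. pX x = 0 \<longrightarrow> pX (W (A (W (A x - B x)))) = 0) \<and>
    (\<forall>y. pY y = 0 \<longrightarrow> (let x = W y - pX (W y); c = A x - B x - pY (A x - B x);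
        u = W c - pX (W c); v = A u - pY (A u) in pX (W v) = 0))"
proof -
  have X: "(\<forall>x. pX (W (A (W (A x - B x)))) = 0) \<longleftrightarrow>
      (\<forall>x. pX x = 0 \<longrightarrow> pX (W (A (W (A x - B x)))) = 0)"
    if eq: "\<forall>x\<in>range (W \<circ> D). A x = B x"
  proof (intro iffI allI impI)
    fix x
    assume *: "\<forall>x. pX x = 0 \<longrightarrow> pX (W (A (W (A x - B x)))) = 0"
    have "A (x - pX x) - B (x - pX x) = A x - B x"
      using bspec[OF eq pX_in] by (simp add: A.diff B.diff)
    moreover have "pX (x - pX x) = 0"
      by (simp add: pX.diff pX_id[OF pX_in])
    ultimately show "pX (W (A (W (A x - B x)))) = 0"
      using * by metis
  qed auto
  have Y: "(\<forall>y. pY (A (W (A (W y) - B (W y)))) = 0) \<longleftrightarrow>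
    (\<forall>y. pY y = 0 \<longrightarrow> (let x = W y - pX (W y); c = A x - B x - pY (A x - B x);
        u = W c - pX (W c); v = A u - pY (A u) in pX (W v) = 0))"
    if eq: "\<forall>x\<in>range (W \<circ> D). A x = B x" and X: "\<forall>x. pX (W (A (W (A x - B x)))) = 0"
  proof -
    have iff: "(let x = W y - pX (W y); c = A x - B x - pY (A x - B x);
        u = W c - pX (W c); v = A u - pY (A u) in pX (W v) = 0) \<longleftrightarrow>
      pY (A (W (A (W y) - B (W y)))) = 0" for y
    proof -
      define x c u v where "x = W y - pX (W y)" and "c = A x - B x - pY (A x - B x)"
        and "u = W c - pX (W c)" and "v = A u - pY (A u)"
      let ?z = "A (W (A x - B x))"
      have x: "A x - B x = A (W y) - B (W y)"
        using bspec[OF eq pX_in] by (simp add: x_def A.diff B.diff)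
      have "?z = A (W (pY (A x - B x))) + A (pX (W c)) + A u"
        by (simp add: c_def u_def A.diff W.diff)
      moreover have "pY (A (W (pY (A x - B x)))) = A (W (pY (A x - B x)))"
          "pY (A (pX (W c))) = A (pX (W c))"
        by (intro pY_id A_range W_range pY_in pX_in)+
      ultimately have "v = ?z - pY ?z"
        by (simp add: v_def pY.add)
      moreover have "pX (W (pY ?z)) = W (pY ?z)"
        by (intro pX_id W_range pY_in)
      \<comment> \<open>The second condition removes the projection of \<open>W ?z\<close>. As
        \<open>W\<close> is injective on the range of \<open>pY\<close>, what remains vanishes
        exactly when \<open>pY ?z\<close> does.\<close>
      ultimately have "pX (W v) = - W (pY ?z)"
        using X by (simp add: W.diff pX.diff)
      moreover have "W (pY ?z) = 0 \<longleftrightarrow> pY ?z = 0"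
        using DWAW[OF pY_in, of ?z] by (metis W.zero A.zero D.zero)
      ultimately have "pX (W v) = 0 \<longleftrightarrow> pY ?z = 0"
        by simp
      then show ?thesis
        by (simp add: Let_def x_def c_def u_def v_def flip: x)
    qed
    show ?thesis
      unfolding iff
    proof (intro iffI allI impI)
      fix y
      assume *: "\<forall>y. pY y = 0 \<longrightarrow> pY (A (W (A (W y) - B (W y)))) = 0"
      have "A (W (y - pY y)) - B (W (y - pY y)) = A (W y) - B (W y)"
        using bspec[OF eq W_range[OF pY_in]] by (simp add: A.diff B.diff W.diff)
      moreover have "pY (y - pY y) = 0"
        by (simp add: pY.diff pY_id[OF pY_in])
      ultimately show "pY (A (W (A (W y) - B (W y)))) = 0"
        using * by metis
    qed auto
  qed
  show ?thesis
    unfolding weighted_weak_group_le_iff_agree using X Y by blast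
qed

text \<open>
  On the two ranges \<open>D\<close> inverts \<open>WAW\<close>, so multiplying the formula for \<open>B\<^sub>2\<close> by \<open>WAW\<close> collapses it
  to a single identity.
\<close>

private lemma upper_right_block_iff:
  fixes x
  defines "c \<equiv> A x - pY (A x) - (B x - pY (B x))"
  defines "u \<equiv> W c - pX (W c)"
  defines "v \<equiv> A u - pY (A u)"
  shows "pY (B x) = pY (A x) + D (W (A (pX (W c)))) + D (W (pY (A u)) + pX (W v)) \<longleftrightarrow>
    pX (W (A (W (A x - B x)))) = 0"
proof -
  \<comment> \<open>\<open>q\<close> and \<open>c\<close> are the upper and lower parts of
    \<open>A x - B x\<close>, and \<open>k\<close> is what \<open>c\<close> contributes to the
    projected identity. That identity reads \<open>k + WAWq = 0\<close>, the formula for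
    \<open>B2\<close> reads \<open>D k = - q\<close>.\<close>
  define q where "q = pY (A x - B x)"
  define k where "k = pX (W (A (W c)))"
  have "W (A (W c)) = W (A (pX (W c))) + W (pY (A u)) + W v"
    by (simp add: u_def v_def A.diff W.diff)
  moreover have "pX (W (A (pX (W c)))) = W (A (pX (W c)))" "pX (W (pY (A u))) = W (pY (A u))"
    by (intro pX_id W_range A_range pY_in pX_in)+
  ultimately have k: "k = W (A (pX (W c))) + (W (pY (A u)) + pX (W v))"
    by (simp add: k_def pX.add)
  have "pX (W (A (W q))) = W (A (W q))"
    unfolding q_def by (intro pX_id W_range A_range pY_in)
  moreover have "A x - B x = c + q"
    by (simp add: c_def q_def pY.diff)
  ultimately have sum: "pX (W (A (W (A x - B x)))) = k + W (A (W q))"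
    by (simp add: k_def W.add A.add pX.add)
  have "pY (B x) = pY (A x) + D (W (A (pX (W c)))) + D (W (pY (A u)) + pX (W v)) \<longleftrightarrow> D k = - q"
    unfolding k q_def by (simp add: D.add pY.diff algebra_simps eq_commute)
  also have "\<dots> \<longleftrightarrow> k = - W (A (W q))"
  proof
    assume "D k = - q"
    then have "W (A (W (D k))) = - W (A (W q))"
      by (simp add: W.neg A.neg)
    then show "k = - W (A (W q))"
      using WAWD[OF pX_in] by (simp add: k_def)
  next
    assume "k = - W (A (W q))"
    then show "D k = - q"
      using DWAW[OF pY_in] by (simp add: D.neg q_def)
  qed
  finally show ?thesis
    by (simp add: sum eq_neg_iff_add_eq_0)
qed

private lemma kernel_eq:
  "null_space (cadjoint (W \<circ> D)) = {x. pX x = 0}" "null_space (cadjoint (D \<circ> W)) = {y. pY y = 0}"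
  using null_space_cadjoint_gdrazin[OF WA gX, folded pX_def]
    null_space_cadjoint_gdrazin[OF AW gY, folded pY_def] by blast+

private lemmas matrix_X_Y_iff = has_op_matrix_upper_iff[OF _
    closed_range_gdrazin[OF WA gX] csubspace_range_gdrazin[OF WA gX] kernel_eq(1)[unfolded pX_def]
    closed_range_gdrazin[OF AW gY] csubspace_range_gdrazin[OF AW gY] kernel_eq(2)[unfolded pY_def],
    folded pX_def pY_def]

private lemmas matrix_Y_X_iff = has_op_matrix_upper_iff[OF _
    closed_range_gdrazin[OF AW gY] csubspace_range_gdrazin[OF AW gY] kernel_eq(2)[unfolded pY_def]
    closed_range_gdrazin[OF WA gX] csubspace_range_gdrazin[OF WA gX] kernel_eq(1)[unfolded pX_def],
    folded pX_def pY_def]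

section \<open>Equivalence with the block conditions\<close>

text \<open>\<open>D\<close> inverts \<open>WAW\<close> between the ranges, so splitting off factors
  gives \<open>WDW\<close> as inverse of \<open>A\<close> and \<open>AWD\<close> as inverse of
  \<open>W\<close>.\<close>

private lemma invertible_ranges:
  "invertible_op (range (W \<circ> D)) (range (D \<circ> W)) A"
  "invertible_op (range (D \<circ> W)) (range (W \<circ> D)) W"
proof -
  note bWD = bounded_operator_comp[OF W bounded_operator_D]
  show "invertible_op (range (W \<circ> D)) (range (D \<circ> W)) A"
    unfolding invertible_op_def
  proof (intro conjI exI[of _ "\<lambda>y. W (D (W y))"] ballI)
    show "bounded_op (range (W \<circ> D)) (range (D \<circ> W)) A"
      using A A_range by (rule bounded_opI)
    show "bounded_op (range (D \<circ> W)) (range (W \<circ> D)) (\<lambda>y. W (D (W y)))"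
      using bounded_operator_comp[OF bWD W] by (rule bounded_opI) auto
    show "W (D (W (A x))) = x" if "x \<in> range (W \<circ> D)" for x
      using WAWD[OF that] by (simp add: AWD)
    show "A (W (D (W y))) = y" if "y \<in> range (D \<circ> W)" for y
      using DWAW[OF that] by (simp add: AWD)
  qed
  show "invertible_op (range (D \<circ> W)) (range (W \<circ> D)) W"
    unfolding invertible_op_def
  proof (intro conjI exI[of _ "\<lambda>x. A (W (D x))"] ballI)
    show "bounded_op (range (D \<circ> W)) (range (W \<circ> D)) W"
      using W W_range by (rule bounded_opI)
    show "bounded_op (range (W \<circ> D)) (range (D \<circ> W)) (\<lambda>x. A (W (D x)))"
      using bounded_operator_comp[OF A bWD] by (rule bounded_opI) (auto simp: AWD)
    show "A (W (D (W y))) = y" if "y \<in> range (D \<circ> W)" for y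
      using DWAW[OF that] by (simp add: AWD)
    show "W (A (W (D x))) = x" if "x \<in> range (W \<circ> D)" for x
      using WAWD[OF that] .
  qed
qed

text \<open>Invertibility and quasinilpotency of the blocks follow from the matrix forms and the
  properties of \<open>D\<close>. The formula for \<open>B2\<close> and the product condition are
  the two projected identities of \<open>weighted_weak_group_le_iff_blocks\<close>.\<close>

private lemma block_conditions_iff:
  defines "X1 \<equiv> range (W \<circ> D)" and "Y1 \<equiv> range (D \<circ> W)"
    and "X2 \<equiv> null_space (cadjoint (W \<circ> D))" and "Y2 \<equiv> null_space (cadjoint (D \<circ> W))"
  assumes mat_A: "has_op_matrix X1 X2 Y1 Y2 A A1 A2 (\<lambda>_. 0) A3"
    and mat_W: "has_op_matrix Y1 Y2 X1 X2 W W1 W2 (\<lambda>_. 0) W3"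
    and mat_B: "has_op_matrix X1 X2 Y1 Y2 B A1 B2 (\<lambda>_. 0) B3"
  shows "invertible_op X1 Y1 A1 \<and> invertible_op Y1 X1 W1 \<and>
      (\<forall>x\<in>X2. B2 x = A2 x + inv_into Y1 W1 (W2 (A3 x - B3 x))
         + inv_into Y1 (W1 \<circ> A1 \<circ> W1)
             (W1 (A2 (W3 (A3 x - B3 x))) + W2 (A3 (W3 (A3 x - B3 x))))) \<and>
      (\<forall>y\<in>Y2. W2 (A3 (W3 (A3 (W3 y) - B3 (W3 y)))) = 0) \<and>
      quasinilpotent_op Y2 (A3 \<circ> W3) \<and> quasinilpotent_op X2 (W3 \<circ> A3) \<longleftrightarrow>
    weighted_weak_group_le W A B"
proof -
  have X2: "X2 = {x. pX x = 0}" and Y2: "Y2 = {y. pY y = 0}"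
    by (simp_all add: X2_def Y2_def kernel_eq)
  have A_eq: "A1 x = A x" if "x \<in> X1" for x
    using mat_A that
    unfolding X1_def X2_def Y1_def Y2_def matrix_X_Y_iff[OF A] by blast
  have A_eq': "A2 x = pY (A x)" "A3 x = A x - pY (A x)" if "pX x = 0" for x
    using mat_A that kernel_eq
    unfolding X1_def X2_def Y1_def Y2_def matrix_X_Y_iff[OF A] by blast+
  have B_eq: "A1 x = B x" if "x \<in> X1" for x
    using mat_B that
    unfolding X1_def X2_def Y1_def Y2_def matrix_X_Y_iff[OF B] by blast
  have B_eq': "B2 x = pY (B x)" "B3 x = B x - pY (B x)" if "pX x = 0" for x
    using mat_B that kernel_eq
    unfolding X1_def X2_def Y1_def Y2_def matrix_X_Y_iff[OF B] by blast+
  have W_eq: "W1 y = W y" if "y \<in> Y1" for y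
    using mat_W that
    unfolding X1_def X2_def Y1_def Y2_def matrix_Y_X_iff[OF W] by blast
  have W_eq': "W2 y = pX (W y)" "W3 y = W y - pX (W y)" if "pY y = 0" for y
    using mat_W that kernel_eq
    unfolding X1_def X2_def Y1_def Y2_def matrix_Y_X_iff[OF W] by blast+
  have ker [simp]: "pX (x - pX x) = 0" "pY (y - pY y) = 0" for x y
    by (simp_all add: pX.diff pY.diff pX_id[OF pX_in] pY_id[OF pY_in])
  have range [simp]: "pX x \<in> X1" "pY y \<in> Y1" for x y
    unfolding X1_def Y1_def by (fact pX_in pY_in)+
  have maps: "x \<in> X1 \<Longrightarrow> A x \<in> Y1" "y \<in> Y1 \<Longrightarrow> W y \<in> X1" "x \<in> X1 \<Longrightarrow> D x \<in> Y1" for x y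
    unfolding X1_def Y1_def by (fact A_range W_range D_range)+
  have inverse: "y \<in> Y1 \<Longrightarrow> D (W (A (W y))) = y" "x \<in> X1 \<Longrightarrow> W (A (W (D x))) = x" for x y
    unfolding X1_def Y1_def by (fact DWAW WAWD)+
  have sub: "cvs.subspace X1" "cvs.subspace Y1" "cvs.subspace X2" "cvs.subspace Y2"
    unfolding X1_def Y1_def X2 Y2
    using csubspace_range_gdrazin[OF WA gX] csubspace_range_gdrazin[OF AW gY]
      bounded_operator_gdrazin_proj[OF WA gX, folded pX_def]
      bounded_operator_gdrazin_proj[OF AW gY, folded pY_def]
    by (auto simp: cvs.subspace_def pX.zero pX.add pY.zero pY.add bounded_operator_iff)

  have "invertible_op X1 Y1 A1"
    using invertible_ranges(1) invertible_op_cong[OF A_eq sub(1), where N = Y1]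
    by (simp add: X1_def Y1_def)
  moreover have "invertible_op Y1 X1 W1"
    using invertible_ranges(2) invertible_op_cong[OF W_eq sub(2), where N = X1]
    by (simp add: X1_def Y1_def)
  moreover have "quasinilpotent_op Y2 (A3 \<circ> W3)"
  proof -
    \<comment> \<open>The part of \<open>W y\<close> dropped by \<open>W3\<close> is mapped by
      \<open>A\<close> into the range of \<open>pY\<close>, so \<open>A3 W3\<close> is the
      compression of \<open>AW\<close>.\<close>
    have eq: "(A3 \<circ> W3) y = (A \<circ> W) y - pY ((A \<circ> W) y)" if "y \<in> Y2" for y
    proof -
      have "pY (A (pX (W y))) = A (pX (W y))"
        by (intro pY_id A_range pX_in)
      with that show ?thesis
        by (simp add: Y2 W_eq' A_eq' A.diff pY.diff)
    qed
    show ?thesis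
      using quasinilpotent_op_cong[where T' = "\<lambda>y. (A \<circ> W) y - pY ((A \<circ> W) y)", OF eq sub(4)]
        gdrazin_compression_quasinilpotent[OF AW gY, folded pY_def Y2_def] by (rule iffD2)
  qed
  moreover have "quasinilpotent_op X2 (W3 \<circ> A3)"
  proof -
    have eq: "(W3 \<circ> A3) x = (W \<circ> A) x - pX ((W \<circ> A) x)" if "x \<in> X2" for x
    proof -
      have "pX (W (pY (A x))) = W (pY (A x))"
        by (intro pX_id W_range pY_in)
      with that show ?thesis
        by (simp add: X2 W_eq' A_eq' W.diff pX.diff)
    qed
    show ?thesis
      using quasinilpotent_op_cong[where T' = "\<lambda>x. (W \<circ> A) x - pX ((W \<circ> A) x)", OF eq sub(3)]
        gdrazin_compression_quasinilpotent[OF WA gX, folded pX_def X2_def] by (rule iffD2)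
  qed
  moreover have "(\<forall>x\<in>X2. B2 x = A2 x + inv_into Y1 W1 (W2 (A3 x - B3 x))
         + inv_into Y1 (W1 \<circ> A1 \<circ> W1)
             (W1 (A2 (W3 (A3 x - B3 x))) + W2 (A3 (W3 (A3 x - B3 x))))) \<longleftrightarrow>
      (\<forall>x. pX x = 0 \<longrightarrow> pX (W (A (W (A x - B x)))) = 0)"
  proof -
    \<comment> \<open>On \<open>X1\<close> the operator \<open>DWA = AWD\<close> is the inverse of
      the restricted \<open>W\<close>.\<close>
    have inv_W1: "inv_into Y1 W1 z = D (W (A z))" if "z \<in> X1" for z
    proof (rule inv_into_f_eq)
      show "inj_on W1 Y1"
        by (rule inj_onI) (metis W_eq inverse(1))
      show "D (W (A z)) \<in> Y1"
        using that by (intro maps)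
      then show "W1 (D (W (A z))) = z"
        using inverse(2)[OF that] by (simp add: W_eq AWD)
    qed
    have WAW: "(W1 \<circ> A1 \<circ> W1) y = W (A (W y))" if "y \<in> Y1" for y
      using that by (simp add: W_eq A_eq maps)
    have inv_WAW: "inv_into Y1 (W1 \<circ> A1 \<circ> W1) z = D z" if "z \<in> X1" for z
    proof (rule inv_into_f_eq)
      show "inj_on (W1 \<circ> A1 \<circ> W1) Y1"
        by (rule inj_onI) (metis WAW inverse(1))
      show "D z \<in> Y1"
        using that by (intro maps)
      then show "(W1 \<circ> A1 \<circ> W1) (D z) = z"
        using inverse(2)[OF that] by (simp only: WAW)
    qed
    have "B2 x = A2 x + inv_into Y1 W1 (W2 (A3 x - B3 x))
         + inv_into Y1 (W1 \<circ> A1 \<circ> W1)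
             (W1 (A2 (W3 (A3 x - B3 x))) + W2 (A3 (W3 (A3 x - B3 x)))) \<longleftrightarrow>
      pX (W (A (W (A x - B x)))) = 0" if x: "pX x = 0" for x
    proof -
      define c where "c = A x - pY (A x) - (B x - pY (B x))"
      define u where "u = W c - pX (W c)"
      define v where "v = A u - pY (A u)"
      have c: "A3 x - B3 x = c" "pY c = 0"
        using x by (simp_all add: c_def A_eq' B_eq' pY.diff pY_id[OF pY_in])
      have u: "W3 c = u" "pX u = 0"
        using c by (simp_all add: u_def W_eq')
      have v: "A3 u = v" "pY v = 0"
        using u by (simp_all add: v_def A_eq')
      have "W (pY (A u)) + pX (W v) \<in> X1"
        using sub(1) by (simp add: cvs.subspace_add maps)
      then show ?thesis
        unfolding c u v using x c(2) u(2) v(2)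
        by (simp add: A_eq' B_eq' W_eq W_eq' inv_W1 inv_WAW
            upper_right_block_iff[of x, folded c_def, folded u_def, folded v_def])
    qed
    then show ?thesis
      by (auto simp: X2)
  qed
  moreover have "(\<forall>y\<in>Y2. W2 (A3 (W3 (A3 (W3 y) - B3 (W3 y)))) = 0) \<longleftrightarrow>
      (\<forall>y. pY y = 0 \<longrightarrow> (let x = W y - pX (W y); c = A x - B x - pY (A x - B x);
        u = W c - pX (W c); v = A u - pY (A u) in pX (W v) = 0))"
  proof -
    have c: "A3 x - B3 x = A x - B x - pY (A x - B x)" if "pX x = 0" for x
      using that by (simp add: A_eq' B_eq' pY.diff)
    show ?thesis
      unfolding Let_def Y2 by (auto simp: W_eq'(2) c) (simp_all add: W_eq' A_eq')
  qed
  \<comment> \<open>The common upper left entry \<open>A1\<close> of both matrices encodes the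
    agreement condition.\<close>
  moreover have "\<forall>x\<in>X1. A x = B x"
    using A_eq B_eq by metis
  ultimately show ?thesis
    unfolding weighted_weak_group_le_iff_blocks X1_def by blast
qed

text \<open>For existence the projected restrictions serve as entries; \<open>A\<close> may also be
  the upper left entry of \<open>B\<close>, because the relation makes them agree there.\<close>

lemma weighted_weak_group_le_iff_matrix:
  "weighted_weak_group_le W A B \<longleftrightarrow>
    (let X1 = range (W \<circ> D); X2 = null_space (cadjoint (W \<circ> D));
         Y1 = range (D \<circ> W); Y2 = null_space (cadjoint (D \<circ> W))
     in \<exists>A1 A2 A3 W1 W2 W3 B2 B3.
          has_op_matrix X1 X2 Y1 Y2 A A1 A2 (\<lambda>_. 0) A3 \<and>
          has_op_matrix Y1 Y2 X1 X2 W W1 W2 (\<lambda>_. 0) W3 \<and>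
          has_op_matrix X1 X2 Y1 Y2 B A1 B2 (\<lambda>_. 0) B3 \<and>
          invertible_op X1 Y1 A1 \<and> invertible_op Y1 X1 W1 \<and>
          (\<forall>x\<in>X2. B2 x = A2 x + inv_into Y1 W1 (W2 (A3 x - B3 x))
             + inv_into Y1 (W1 \<circ> A1 \<circ> W1)
                 (W1 (A2 (W3 (A3 x - B3 x))) + W2 (A3 (W3 (A3 x - B3 x))))) \<and>
          (\<forall>y\<in>Y2. W2 (A3 (W3 (A3 (W3 y) - B3 (W3 y)))) = 0) \<and>
          quasinilpotent_op Y2 (A3 \<circ> W3) \<and> quasinilpotent_op X2 (W3 \<circ> A3))"
  (is "?le \<longleftrightarrow> ?matrix")
proof
  assume ?le
  then have AB: "\<forall>x\<in>range (W \<circ> D). A x = B x"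
    by (simp add: weighted_weak_group_le_iff_blocks)
  let ?X1 = "range (W \<circ> D)" and ?X2 = "null_space (cadjoint (W \<circ> D))"
    and ?Y1 = "range (D \<circ> W)" and ?Y2 = "null_space (cadjoint (D \<circ> W))"
  have mat_A: "has_op_matrix ?X1 ?X2 ?Y1 ?Y2 A A (\<lambda>x. pY (A x)) (\<lambda>_. 0) (\<lambda>x. A x - pY (A x))"
    unfolding matrix_X_Y_iff[OF A] using A_range by blast
  have mat_W: "has_op_matrix ?Y1 ?Y2 ?X1 ?X2 W W (\<lambda>y. pX (W y)) (\<lambda>_. 0) (\<lambda>y. W y - pX (W y))"
    unfolding matrix_Y_X_iff[OF W] using W_range by blast
  have mat_B: "has_op_matrix ?X1 ?X2 ?Y1 ?Y2 B A (\<lambda>x. pY (B x)) (\<lambda>_. 0) (\<lambda>x. B x - pY (B x))"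
    unfolding matrix_X_Y_iff[OF B] using A_range AB by metis
  show ?matrix
    unfolding Let_def using mat_A mat_W mat_B block_conditions_iff[OF mat_A mat_W mat_B] \<open>?le\<close>
    by blast
next
  assume ?matrix
  then show ?le
    unfolding Let_def using block_conditions_iff by blast
qed

end

theorem corollary3p1:
  fixes A B :: "'a::chilbert_space \<Rightarrow> 'b::chilbert_space"
    and W :: "'b \<Rightarrow> 'a"
  assumes "infinite_cdim TYPE('a)" and "infinite_cdim TYPE('b)"
    and "bounded_operator W" and "W \<noteq> (\<lambda>_. 0)"
    and "bounded_operator A" and "wgdrazin_invertible W A"
    and "bounded_operator B"
  shows "weighted_weak_group_le W A B \<longleftrightarrow>
    (let X1 = range (gdrazin_inv (W \<circ> A));
         X2 = null_space (cadjoint (gdrazin_inv (W \<circ> A)));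
         Y1 = range (gdrazin_inv (A \<circ> W));
         Y2 = null_space (cadjoint (gdrazin_inv (A \<circ> W)))
     in \<exists>A1 A2 A3 W1 W2 W3 B2 B3.
          has_op_matrix X1 X2 Y1 Y2 A A1 A2 (\<lambda>_. 0) A3 \<and>
          has_op_matrix Y1 Y2 X1 X2 W W1 W2 (\<lambda>_. 0) W3 \<and>
          has_op_matrix X1 X2 Y1 Y2 B A1 B2 (\<lambda>_. 0) B3 \<and>
          invertible_op X1 Y1 A1 \<and> invertible_op Y1 X1 W1 \<and>
          (\<forall>x\<in>X2. B2 x = A2 x + inv_into Y1 W1 (W2 (A3 x - B3 x))
             + inv_into Y1 (W1 \<circ> A1 \<circ> W1)
                 (W1 (A2 (W3 (A3 x - B3 x))) + W2 (A3 (W3 (A3 x - B3 x))))) \<and>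
          (\<forall>y\<in>Y2. W2 (A3 (W3 (A3 (W3 y) - B3 (W3 y)))) = 0) \<and>
          quasinilpotent_op Y2 (A3 \<circ> W3) \<and> quasinilpotent_op X2 (W3 \<circ> A3))"
proof -
  note W = assms(3) and A = assms(5) and B = assms(7)
  obtain D where D: "is_wgdrazin_inv W A D"
    using assms(6) by (auto simp: wgdrazin_invertible_def)
  have "bounded_operator (A \<circ> W)" "bounded_operator (W \<circ> A)"
    using bounded_operator_comp[OF A W] bounded_operator_comp[OF W A] by (simp_all add: comp_def)
  \<comment> \<open>Uniqueness identifies the g-Drazin inverses in the statement with
    \<open>DW\<close> and \<open>WD\<close>.\<close>
  then have "gdrazin_inv (A \<circ> W) = D \<circ> W" "gdrazin_inv (W \<circ> A) = W \<circ> D"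
    using wgdrazin_imp_gdrazin[OF A W D] by (simp_all add: gdrazin_inv_eqI)
  then show ?thesis
    using weighted_weak_group_le_iff_matrix[OF W A B D] by presburger
qed

end
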